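(* For $\varepsilon>k^2/n$, one can $\varepsilon$-test (in the standard property testing model) whether a Boolean function $f:[n]\to\{0,1\}$ has at most $k$ runs using $O\!\left(\min\left\{\frac{k\log k}{\varepsilon},\frac{\sqrt{k}}{\varepsilon^{6}}\right\}\right)$ uniform and independent queries.
   Context: A function $f:[n]\to\{0,1\}$ has (at most) $k$ runs if the sequence $f(1),f(2),\dots,f(n)$ has at most $k-1$ alternations of values. An $\varepsilon$-tester for a property accepts functions having the property and rejects functions that must be changed on at least an $\varepsilon$ fraction of the domain to have the property, each with probability at least $2/3$. Uniform and independent queries are domain points sampled uniformly and independently at random.
   Formalization: The factor log k is read as max(1, log₂ k), which changes the bound only for k = 1, where the literal k log k = 0 would allow no queries and the claim would be false; n and k are taken to be at least 1. *)

theory Defs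
  imports "HOL-Probability.Probability"
begin

text \<open>
  A function \<open>f : [n] \<rightarrow> {0,1}\<close> is a function of type \<^typ>\<open>nat \<Rightarrow> bool\<close> of which only the values on
  \<open>{1..n}\<close> matter.
\<close>

definition alternations :: "nat \<Rightarrow> (nat \<Rightarrow> bool) \<Rightarrow> nat"
  where "alternations n f = card {i \<in> {1..<n}. f i \<noteq> f (i + 1)}"

text \<open>At most \<open>k - 1\<close> alternations, written without truncated subtraction.\<close>

definition has_runs :: "nat \<Rightarrow> nat \<Rightarrow> (nat \<Rightarrow> bool) \<Rightarrow> bool"
  where "has_runs n k f \<longleftrightarrow> alternations n f + 1 \<le> k"

definition far_from :: "nat \<Rightarrow> ((nat \<Rightarrow> bool) \<Rightarrow> bool) \<Rightarrow> real \<Rightarrow> (nat \<Rightarrow> bool) \<Rightarrow> bool"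
  where "far_from n P \<epsilon> f \<longleftrightarrow>
    (\<forall>g. P g \<longrightarrow> real (card {i \<in> {1..n}. f i \<noteq> g i}) / real n \<ge> \<epsilon>)"

text \<open>
  A tester restricted to uniform and independent queries is a map from the list of labelled samples
  to a verdict (\<^const>\<open>True\<close> means accept) that may use further internal randomness. It has no other
  access to \<open>f\<close>.
\<close>

type_synonym sample_tester = "(nat \<times> bool) list \<Rightarrow> bool pmf"

definition run_tester :: "nat \<Rightarrow> nat \<Rightarrow> sample_tester \<Rightarrow> (nat \<Rightarrow> bool) \<Rightarrow> bool pmf"
  where "run_tester n q T f =
    bind_pmf (replicate_pmf q (pmf_of_set {1..n})) (\<lambda>xs. T (map (\<lambda>x. (x, f x)) xs))"

definition is_tester ::
    "nat \<Rightarrow> ((nat \<Rightarrow> bool) \<Rightarrow> bool) \<Rightarrow> real \<Rightarrow> nat \<Rightarrow> sample_tester \<Rightarrow> bool"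
  where "is_tester n P \<epsilon> q T \<longleftrightarrow>
    (\<forall>f. P f \<longrightarrow> pmf (run_tester n q T f) True \<ge> 2 / 3) \<and>
    (\<forall>f. far_from n P \<epsilon> f \<longrightarrow> pmf (run_tester n q T f) False \<ge> 2 / 3)"

text \<open>
  The expression under the \<open>O\<close>. The factor \<open>log k\<close> is read as at least \<open>1\<close>: for \<open>k \<ge> 2\<close> the maximum
  is exactly \<open>log 2 k\<close>, while for \<open>k = 1\<close> a literal \<open>log 1 = 0\<close> would allow no query at all, although
  testing constancy needs some.
\<close>

definition query_bound :: "nat \<Rightarrow> real \<Rightarrow> real"
  where "query_bound k \<epsilon> = min (real k * max 1 (log 2 (real k)) / \<epsilon>) (sqrt (real k) / \<epsilon> ^ 6)"

end

theory Submission
  imports Defs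
begin

text \<open>
  The bound \<open>k log k / \<epsilon>\<close> comes from accepting iff the sample is consistent with some function with
  \<open>k\<close> runs: a far function has \<open>k\<close> disjoint intervals in each of which both values occur about
  \<open>\<epsilon> n / k\<close> times (else majority votes on the greedy intervals would give a close function with \<open>k\<close> runs),
  and a coupon collector argument hits all these \<open>2 k\<close> sets.

  The bound \<open>sqrt k / \<epsilon> ^ 6\<close> comes from estimating the weighted number \<open>H\<close> of unordered pairs \<open>x\<close>, \<open>y\<close> with
  \<open>f x \<noteq> f y\<close> and weight \<open>max 0 (w - \<bar>x - y\<bar>)\<close>, where \<open>w \<approx> \<epsilon>\<^sup>2 n / (64 k)\<close>. Each alternation contributes at most
  \<open>w\<^sup>3 / 6\<close> to \<open>H\<close>. Conversely, \<open>H\<close> is at least the sum of \<open>a x * (w - a x)\<close> over all windows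
  \<open>{x..<x + w}\<close>, where \<open>a x\<close> counts the ones in the window. As \<open>a\<close> changes by at most 1 per step, every
  passage between \<open>a \<approx> 0\<close> and \<open>a \<approx> w\<close> sweeps over all intermediate levels and contributes almost \<open>w\<^sup>3 / 6\<close>. So if
  \<open>H\<close> is below \<open>(1 + \<epsilon> / 8) k w\<^sup>3 / 6\<close>, rounding \<open>a\<close> with hysteresis gives a function close to \<open>f\<close> with
  few more than \<open>k\<close> runs, and flipping its shortest runs one at a time leaves \<open>k\<close> runs at small cost.
  The gap in \<open>H\<close> is detected by Chebyshev's inequality. If \<open>k \<epsilon>\<^sup>5\<close> is bounded, the first bound is already of the
  order of the minimum; otherwise \<open>\<epsilon> > k\<^sup>2 / n\<close> makes \<open>w\<close> large enough for rounding to be harmless.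
\<close>

section \<open>Uniform samples\<close>

abbreviation samples :: "'a set \<Rightarrow> nat \<Rightarrow> 'a list set"
  where "samples A q \<equiv> {xs. set xs \<subseteq> A \<and> length xs = q}"

lemma samples_Suc: "samples A (Suc q) = (\<lambda>(x, xs). x # xs) ` (A \<times> samples A q)"
  by (force simp: length_Suc_conv image_iff)

lemma sum_samples_Suc:
  "(\<Sum>xs\<in>samples A (Suc q). \<phi> xs) = (\<Sum>x\<in>A. \<Sum>xs\<in>samples A q. \<phi> (x # xs))"
proof -
  have "inj_on (\<lambda>(x, xs). x # xs) (A \<times> samples A q)"
    by (auto simp: inj_on_def)
  then show ?thesis
    by (simp add: samples_Suc sum.reindex sum.cartesian_product case_prod_unfold)
qed

lemma samples_nonempty:
  assumes "A \<noteq> {}"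
  shows "samples A q \<noteq> {}"
proof -
  obtain a where "a \<in> A" using assms by auto
  then have "replicate q a \<in> samples A q" by auto
  then show ?thesis by blast
qed

text \<open>Independent uniform draws make all lists of length \<open>q\<close> over
  \<open>A\<close> equally likely, which turns acceptance probabilities into counts of
  lists.\<close>

lemma replicate_pmf_of_set:
  assumes "finite A" "A \<noteq> {}"
  shows "replicate_pmf q (pmf_of_set A) = pmf_of_set (samples A q)"
proof (induction q)
  case 0
  have "samples A 0 = {[]}" by auto
  then show ?case by (simp add: pmf_of_set_singleton)
next
  case (Suc q)
  have ne: "samples A m \<noteq> {}" for m
    by (rule samples_nonempty[OF assms(2)])
  have fin: "finite (samples A m)" for m
    by (rule finite_lists_length_eq[OF assms(1)])
  have "replicate_pmf (Suc q) (pmf_of_set A) =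
      map_pmf (\<lambda>(x, xs). x # xs) (pair_pmf (pmf_of_set A) (pmf_of_set (samples A q)))"
    by (simp add: Suc pair_pmf_def map_bind_pmf)
  also have "pair_pmf (pmf_of_set A) (pmf_of_set (samples A q)) = pmf_of_set (A \<times> samples A q)"
  proof (rule pmf_eqI)
    fix z :: "'a \<times> 'a list"
    have "A \<times> samples A q \<noteq> {}" using assms(2) ne by (simp only: Times_empty) simp
    then show "pmf (pair_pmf (pmf_of_set A) (pmf_of_set (samples A q))) z =
        pmf (pmf_of_set (A \<times> samples A q)) z"
      using assms fin ne[of q]
      by (cases z) (simp add: pmf_pair pmf_of_set indicator_def card_cartesian_product
          del: Collect_empty_eq)
  qed
  also have "map_pmf (\<lambda>(x, xs). x # xs) \<dots> = pmf_of_set (samples A (Suc q))"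
    unfolding samples_Suc using assms fin ne
    by (intro map_pmf_of_set_inj) (auto simp: inj_on_def)
  finally show ?case .
qed

lemma pmf_run_tester:
  assumes "n \<ge> 1"
  shows "pmf (run_tester n q (\<lambda>s. return_pmf (V s)) f) b =
    real (card {xs \<in> samples {1..n} q. V (map (\<lambda>x. (x, f x)) xs) = b}) / real n ^ q"
proof -
  have fin: "finite (samples {1..n} q)"
    by (rule finite_lists_length_eq) simp
  have ne: "samples {1..n} q \<noteq> {}"
    using assms by (intro samples_nonempty) simp
  have "run_tester n q (\<lambda>s. return_pmf (V s)) f =
      map_pmf (\<lambda>xs. V (map (\<lambda>x. (x, f x)) xs)) (pmf_of_set (samples {1..n} q))"
    using assms by (simp add: run_tester_def replicate_pmf_of_set map_pmf_def)
  then have "pmf (run_tester n q (\<lambda>s. return_pmf (V s)) f) b =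
      real (card (samples {1..n} q \<inter> (\<lambda>xs. V (map (\<lambda>x. (x, f x)) xs)) -` {b}))
        / real (card (samples {1..n} q))"
    using fin ne by (simp add: pmf_map measure_pmf_of_set)
  also have "samples {1..n} q \<inter> (\<lambda>xs. V (map (\<lambda>x. (x, f x)) xs)) -` {b} =
      {xs \<in> samples {1..n} q. V (map (\<lambda>x. (x, f x)) xs) = b}"
    by auto
  finally show ?thesis
    by (simp add: card_lists_length_eq)
qed

text \<open>Both testers below decide deterministically from the sample, so an error probability of
  at most 1/3 is a bound on three times the number of bad lists.\<close>

lemma is_tester_detI:
  assumes n: "n \<ge> 1"
    and yes: "\<And>f. P f \<Longrightarrow>
      3 * real (card {xs \<in> samples {1..n} q. \<not> V (map (\<lambda>x. (x, f x)) xs)}) \<le> real n ^ q"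
    and no: "\<And>f. far_from n P \<epsilon> f \<Longrightarrow>
      3 * real (card {xs \<in> samples {1..n} q. V (map (\<lambda>x. (x, f x)) xs)}) \<le> real n ^ q"
  shows "is_tester n P \<epsilon> q (\<lambda>s. return_pmf (V s))"
proof -
  have compl: "pmf p b = 1 - pmf p (\<not> b)" for p b
    by (cases b) (simp_all add: pmf_False_conv_True)
  have pos: "real n ^ q > 0" using n by simp
  have "pmf (run_tester n q (\<lambda>s. return_pmf (V s)) f) True \<ge> 2 / 3" if "P f" for f
  proof -
    have "pmf (run_tester n q (\<lambda>s. return_pmf (V s)) f) False \<le> 1 / 3"
      using yes[OF that] pos by (simp add: pmf_run_tester[OF n] divide_le_eq)
    then show ?thesis by (subst compl) simp
  qed
  moreover have "pmf (run_tester n q (\<lambda>s. return_pmf (V s)) f) False \<ge> 2 / 3"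
    if "far_from n P \<epsilon> f" for f
  proof -
    have "pmf (run_tester n q (\<lambda>s. return_pmf (V s)) f) True \<le> 1 / 3"
      using no[OF that] pos by (simp add: pmf_run_tester[OF n] divide_le_eq)
    then show ?thesis by (subst compl) simp
  qed
  ultimately show ?thesis by (simp add: is_tester_def)
qed

section \<open>Second moments of pair statistics\<close>

text \<open>Expectation under the uniform distribution on \<open>A\<close>, kept as a finite sum so
  that independence becomes the algebra of iterated sums.\<close>

definition avg :: "'a set \<Rightarrow> ('a \<Rightarrow> real) \<Rightarrow> real"
  where "avg A \<phi> = (\<Sum>x\<in>A. \<phi> x) / real (card A)"

lemma avg_add: "avg A (\<lambda>x. \<phi> x + \<psi> x) = avg A \<phi> + avg A \<psi>"
  by (simp add: avg_def sum.distrib add_divide_distrib)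

lemma avg_cmult: "avg A (\<lambda>x. c * \<phi> x) = c * avg A \<phi>"
  by (simp add: avg_def sum_distrib_left[symmetric])

lemma avg_const: "finite A \<Longrightarrow> A \<noteq> {} \<Longrightarrow> avg A (\<lambda>_. c) = c"
  by (simp add: avg_def)

lemma avg_mono: "(\<And>x. x \<in> A \<Longrightarrow> \<phi> x \<le> \<psi> x) \<Longrightarrow> avg A \<phi> \<le> avg A \<psi>"
  by (auto simp: avg_def intro!: divide_right_mono sum_mono)

lemma avg_nonneg: "(\<And>x. x \<in> A \<Longrightarrow> 0 \<le> \<phi> x) \<Longrightarrow> 0 \<le> avg A \<phi>"
  by (auto simp: avg_def intro!: divide_nonneg_nonneg sum_nonneg)

lemma avg_cong: "(\<And>x. x \<in> A \<Longrightarrow> \<phi> x = \<psi> x) \<Longrightarrow> avg A \<phi> = avg A \<psi>"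
  by (simp add: avg_def)

lemma avg_swap: "avg A (\<lambda>x. avg B (\<lambda>y. \<phi> x y)) = avg B (\<lambda>y. avg A (\<lambda>x. \<phi> x y))"
  unfolding avg_def sum_divide_distrib[symmetric] by (subst sum.swap) (simp add: mult.commute)

lemma avg_samples_0: "avg (samples A 0) \<phi> = \<phi> []"
proof -
  have "samples A 0 = {[]}" by auto
  then show ?thesis by (simp add: avg_def)
qed

lemma avg_samples_Suc:
  assumes "finite A"
  shows "avg (samples A (Suc q)) \<phi> = avg A (\<lambda>x. avg (samples A q) (\<lambda>xs. \<phi> (x # xs)))"
proof -
  have "card (samples A (Suc q)) = card A * card (samples A q)"
    using assms by (simp add: card_lists_length_eq)
  then show ?thesis
    unfolding avg_def sum_samples_Suc by (simp add: sum_divide_distrib[symmetric] mult.commute)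
qed

lemma avg_samples_add:
  assumes "finite A"
  shows "avg (samples A (p + q)) \<phi> = avg (samples A p) (\<lambda>xs. avg (samples A q) (\<lambda>ys. \<phi> (xs @ ys)))"
proof (induction p arbitrary: \<phi>)
  case 0
  show ?case by (simp only: avg_samples_0 add_0 append_Nil)
next
  case (Suc p)
  show ?case
    by (simp only: add_Suc avg_samples_Suc[OF assms] Suc append_Cons)
qed

lemma avg_sum_list: "avg A (\<lambda>x. sum_list (map (\<phi> x) ys)) = sum_list (map (\<lambda>y. avg A (\<lambda>x. \<phi> x y)) ys)"
proof (induction ys)
  case Nil
  show ?case by (simp add: avg_def)
next
  case (Cons y ys)
  then show ?case by (simp add: avg_add)
qed

lemma avg_samples_sum:
  assumes A: "finite A" "A \<noteq> {}"
  shows "avg (samples A q) (\<lambda>xs. sum_list (map \<phi> xs)) = real q * avg A \<phi>"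
proof (induction q)
  case 0
  show ?case by (simp only: avg_samples_0) simp
next
  case (Suc q)
  show ?case
    by (simp only: avg_samples_Suc[OF A(1)] list.map sum_list.Cons avg_add Suc
        avg_const[OF finite_lists_length_eq[OF A(1)] samples_nonempty[OF A(2)]] avg_const[OF A])
      (simp add: algebra_simps)
qed

text \<open>In the expanded square the \<open>q\<close> diagonal terms give the second moment of
  \<open>\<phi>\<close>, and the \<open>q * (q - 1)\<close> mixed terms factor by
  independence.\<close>

lemma avg_samples_sum_square:
  assumes A: "finite A" "A \<noteq> {}"
  shows "avg (samples A q) (\<lambda>xs. (sum_list (map \<phi> xs))\<^sup>2) =
    real q * avg A (\<lambda>x. (\<phi> x)\<^sup>2) + real q * (real q - 1) * (avg A \<phi>)\<^sup>2"
proof (induction q)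
  case 0
  show ?case by (simp only: avg_samples_0) simp
next
  case (Suc q)
  have sq: "(\<phi> x + sum_list (map \<phi> xs))\<^sup>2 =
      (\<phi> x)\<^sup>2 + (2 * \<phi> x * sum_list (map \<phi> xs) + (sum_list (map \<phi> xs))\<^sup>2)" for x xs
    by (simp add: power2_sum)
  have "avg (samples A (Suc q)) (\<lambda>xs. (sum_list (map \<phi> xs))\<^sup>2) =
      avg A (\<lambda>x. (\<phi> x)\<^sup>2) + (avg A (\<lambda>x. 2 * \<phi> x * (real q * avg A \<phi>)) +
        (real q * avg A (\<lambda>x. (\<phi> x)\<^sup>2) + real q * (real q - 1) * (avg A \<phi>)\<^sup>2))"
    by (simp only: avg_samples_Suc[OF A(1)] list.map sum_list.Cons sq avg_add avg_cmult Suc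
        avg_samples_sum[OF A]
        avg_const[OF finite_lists_length_eq[OF A(1)] samples_nonempty[OF A(2)]] avg_const[OF A])
  also have "avg A (\<lambda>x. 2 * \<phi> x * (real q * avg A \<phi>)) = 2 * real q * avg A \<phi> * avg A \<phi>"
    using avg_cmult[of A "2 * (real q * avg A \<phi>)" \<phi>] by (simp add: mult_ac)
  finally show ?case by (simp add: algebra_simps power2_eq_square)
qed

text \<open>Only pairs across the two halves of the sample enter. Conditioned on one half, the statistic is
  then a sum of independent terms, so its second moment is exact and follows from
  \<open>avg_samples_sum_square\<close> applied once to each half.\<close>

definition pair_sum :: "('a \<Rightarrow> 'a \<Rightarrow> real) \<Rightarrow> nat \<Rightarrow> 'a list \<Rightarrow> real"
  where "pair_sum h q zs = (\<Sum>x\<leftarrow>take q zs. \<Sum>y\<leftarrow>drop q zs. h x y)"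

text \<open>The variance is exactly \<open>q^2 * E2 + q^2 * (q - 1) * (R + C) + q^2 * ((q - 1)^2 -
  q^2) * \<mu>^2\<close>, where \<open>R\<close> and \<open>C\<close> are the mean squares of the
  row and column averages. Bounding one factor of each square by its maximum gives
  \<open>E2 \<le> b * \<mu>\<close> and \<open>R, C \<le> \<beta> * \<mu>\<close>; the last term is
  nonpositive.\<close>

lemma pair_sum_variance:
  fixes h :: "'a \<Rightarrow> 'a \<Rightarrow> real"
  assumes A: "finite A" "A \<noteq> {}"
    and h: "\<And>x y. 0 \<le> h x y" "\<And>x y. h x y \<le> b"
    and row: "\<And>x. x \<in> A \<Longrightarrow> avg A (\<lambda>y. h x y) \<le> \<beta>"
    and col: "\<And>y. y \<in> A \<Longrightarrow> avg A (\<lambda>x. h x y) \<le> \<beta>"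
  defines "\<mu> \<equiv> avg A (\<lambda>x. avg A (\<lambda>y. h x y))"
  shows "avg (samples A (q + q)) (\<lambda>zs. (pair_sum h q zs - (real q)\<^sup>2 * \<mu>)\<^sup>2) \<le>
    (real q)\<^sup>2 * b * \<mu> + 2 * real q ^ 3 * \<beta> * \<mu>"
proof -
  let ?S = "samples A q"
  have S: "finite ?S" "?S \<noteq> {}"
    using finite_lists_length_eq[OF A(1)] samples_nonempty[OF A(2)] by auto
  let ?U = "\<lambda>xs ys. \<Sum>x\<leftarrow>xs. \<Sum>y\<leftarrow>ys. h x y"
  define r where "r x = avg A (\<lambda>y. h x y)" for x
  define c where "c y = avg A (\<lambda>x. h x y)" for y
  define E2 where "E2 = avg A (\<lambda>x. avg A (\<lambda>y. (h x y)\<^sup>2))"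
  have mu_r: "avg A r = \<mu>" by (simp only: \<mu>_def r_def[abs_def])
  have mu_c: "avg A c = \<mu>" unfolding \<mu>_def c_def[abs_def] by (rule avg_swap)
  have first: "avg ?S (\<lambda>xs. avg ?S (\<lambda>ys. ?U xs ys)) = (real q)\<^sup>2 * \<mu>"
  proof -
    have "avg ?S (\<lambda>xs. avg ?S (\<lambda>ys. ?U xs ys)) = avg ?S (\<lambda>ys. avg ?S (\<lambda>xs. ?U xs ys))"
      by (rule avg_swap)
    also have "\<dots> = real q * (avg ?S (\<lambda>ys. \<Sum>y\<leftarrow>ys. c y))"
      by (simp only: avg_samples_sum[OF A] avg_sum_list avg_cmult c_def)
    also have "\<dots> = (real q)\<^sup>2 * \<mu>"
      by (simp only: avg_samples_sum[OF A] mu_c) (simp add: power2_eq_square)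
    finally show ?thesis .
  qed
  have second: "avg ?S (\<lambda>xs. avg ?S (\<lambda>ys. (?U xs ys)\<^sup>2)) =
      real q * (real q * E2 + real q * (real q - 1) * avg A (\<lambda>x. (r x)\<^sup>2)) +
      real q * (real q - 1) * (real q * avg A (\<lambda>y. (c y)\<^sup>2) + real q * (real q - 1) * \<mu>\<^sup>2)"
  proof -
    have "avg ?S (\<lambda>xs. avg ?S (\<lambda>ys. (?U xs ys)\<^sup>2)) = avg ?S (\<lambda>ys. avg ?S (\<lambda>xs. (?U xs ys)\<^sup>2))"
      by (rule avg_swap)
    also have "\<dots> = real q * avg ?S (\<lambda>ys. avg A (\<lambda>x. (\<Sum>y\<leftarrow>ys. h x y)\<^sup>2)) +
        real q * (real q - 1) * avg ?S (\<lambda>ys. (\<Sum>y\<leftarrow>ys. c y)\<^sup>2)"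
      by (simp only: avg_samples_sum_square[OF A] avg_sum_list avg_add avg_cmult c_def)
    also have "avg ?S (\<lambda>ys. avg A (\<lambda>x. (\<Sum>y\<leftarrow>ys. h x y)\<^sup>2)) =
        avg A (\<lambda>x. avg ?S (\<lambda>ys. (\<Sum>y\<leftarrow>ys. h x y)\<^sup>2))"
      by (rule avg_swap)
    also have "\<dots> = real q * E2 + real q * (real q - 1) * avg A (\<lambda>x. (r x)\<^sup>2)"
      by (simp only: avg_samples_sum_square[OF A] avg_add avg_cmult r_def E2_def)
    also have "avg ?S (\<lambda>ys. (\<Sum>y\<leftarrow>ys. c y)\<^sup>2) =
        real q * avg A (\<lambda>y. (c y)\<^sup>2) + real q * (real q - 1) * \<mu>\<^sup>2"
      by (simp only: avg_samples_sum_square[OF A] mu_c)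
    finally show ?thesis .
  qed
  have c0: "0 \<le> c y" and r0: "0 \<le> r x" for x y
    unfolding c_def r_def by (intro avg_nonneg h(1))+
  have mu0: "0 \<le> \<mu>"
    unfolding mu_c[symmetric] by (intro avg_nonneg c0)
  have E2: "E2 \<le> b * \<mu>"
  proof -
    have "E2 \<le> avg A (\<lambda>x. avg A (\<lambda>y. b * h x y))"
      unfolding E2_def power2_eq_square using h by (intro avg_mono mult_right_mono)
    then show ?thesis by (simp only: avg_cmult \<mu>_def)
  qed
  have R2: "avg A (\<lambda>x. (r x)\<^sup>2) \<le> \<beta> * \<mu>"
  proof -
    have "avg A (\<lambda>x. (r x)\<^sup>2) \<le> avg A (\<lambda>x. \<beta> * r x)"
      unfolding power2_eq_square using r0 row by (intro avg_mono mult_right_mono) (auto simp: r_def)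
    then show ?thesis by (simp only: avg_cmult mu_r)
  qed
  have C2: "avg A (\<lambda>y. (c y)\<^sup>2) \<le> \<beta> * \<mu>"
  proof -
    have "avg A (\<lambda>x. (c x)\<^sup>2) \<le> avg A (\<lambda>x. \<beta> * c x)"
      unfolding power2_eq_square using c0 col by (intro avg_mono mult_right_mono) (auto simp: c_def)
    then show ?thesis by (simp only: avg_cmult mu_c)
  qed
  have \<beta>\<mu>0: "0 \<le> \<beta> * \<mu>"
    by (rule order_trans[OF avg_nonneg C2]) simp
  have "avg (samples A (q + q)) (\<lambda>zs. (pair_sum h q zs - (real q)\<^sup>2 * \<mu>)\<^sup>2) =
      avg ?S (\<lambda>xs. avg ?S (\<lambda>ys. (?U xs ys - (real q)\<^sup>2 * \<mu>)\<^sup>2))"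
    unfolding avg_samples_add[OF A(1)] by (intro avg_cong) (simp add: pair_sum_def)
  also have "\<dots> = avg ?S (\<lambda>xs. avg ?S (\<lambda>ys.
      (?U xs ys)\<^sup>2 + ((- 2 * (real q)\<^sup>2 * \<mu>) * ?U xs ys + ((real q)\<^sup>2 * \<mu>)\<^sup>2)))"
    by (intro avg_cong) (simp add: power2_eq_square algebra_simps)
  also have "\<dots> = avg ?S (\<lambda>xs. avg ?S (\<lambda>ys. (?U xs ys)\<^sup>2)) +
      ((- 2 * (real q)\<^sup>2 * \<mu>) * avg ?S (\<lambda>xs. avg ?S (\<lambda>ys. ?U xs ys)) + ((real q)\<^sup>2 * \<mu>)\<^sup>2)"
    by (simp only: avg_add avg_cmult avg_const[OF S])
  also have "\<dots> = (real q)\<^sup>2 * E2 +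
      (real q)\<^sup>2 * (real q - 1) * (avg A (\<lambda>x. (r x)\<^sup>2) + avg A (\<lambda>y. (c y)\<^sup>2)) +
      (real q)\<^sup>2 * ((real q - 1)\<^sup>2 - (real q)\<^sup>2) * \<mu>\<^sup>2"
    unfolding first second by (simp add: algebra_simps power2_eq_square)
  also have "\<dots> \<le> (real q)\<^sup>2 * (b * \<mu>) + real q ^ 3 * (\<beta> * \<mu> + \<beta> * \<mu>) + 0"
  proof (intro add_mono mult_left_mono E2)
    show "(real q)\<^sup>2 * (real q - 1) * (avg A (\<lambda>x. (r x)\<^sup>2) + avg A (\<lambda>y. (c y)\<^sup>2))
        \<le> real q ^ 3 * (\<beta> * \<mu> + \<beta> * \<mu>)"
    proof (cases "q = 0")
      case False
      have "(real q)\<^sup>2 * (real q - 1) \<le> real q ^ 3"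
        by (simp add: power2_eq_square power3_eq_cube algebra_simps)
      moreover have "0 \<le> (real q)\<^sup>2 * (real q - 1)" using False by simp
      ultimately show ?thesis using R2 C2
        by (intro mult_mono add_mono add_nonneg_nonneg avg_nonneg) auto
    qed simp
    show "(real q)\<^sup>2 * ((real q - 1)\<^sup>2 - (real q)\<^sup>2) * \<mu>\<^sup>2 \<le> 0"
    proof (cases "q = 0")
      case False
      then have "(real q - 1)\<^sup>2 \<le> (real q)\<^sup>2" by (intro power_mono) auto
      then show ?thesis by (intro mult_nonpos_nonneg mult_nonneg_nonpos) auto
    qed simp
  qed auto
  finally show ?thesis by (simp add: algebra_simps)
qed

text \<open>Markov's inequality for the squared deviation, multiplied out so that it bounds a number
  of elements.\<close>

lemma chebyshev_count:
  assumes "finite S" "t > 0"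
    and "avg S (\<lambda>z. (F z - m)\<^sup>2) \<le> V"
    and "\<And>z. z \<in> S \<Longrightarrow> P z \<Longrightarrow> t \<le> \<bar>F z - m\<bar>"
  shows "real (card {z \<in> S. P z}) * t\<^sup>2 \<le> V * real (card S)"
proof (cases "S = {}")
  case False
  have "real (card {z \<in> S. P z}) * t\<^sup>2 = (\<Sum>z\<in>{z \<in> S. P z}. t\<^sup>2)" by simp
  also have "\<dots> \<le> (\<Sum>z\<in>{z \<in> S. P z}. (F z - m)\<^sup>2)"
    using assms(2,4) by (intro sum_mono) (metis (lifting) less_imp_le mem_Collect_eq power2_abs power_mono)
  also have "\<dots> \<le> (\<Sum>z\<in>S. (F z - m)\<^sup>2)"
    using assms(1) by (intro sum_mono2) auto
  also have "\<dots> = avg S (\<lambda>z. (F z - m)\<^sup>2) * real (card S)"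
    using False assms(1) by (simp add: avg_def)
  also have "\<dots> \<le> V * real (card S)"
    using assms(3) by (intro mult_right_mono) auto
  finally show ?thesis .
qed simp

section \<open>Runs, windows and hysteresis\<close>

lemma alternation_between:
  fixes g :: "nat \<Rightarrow> bool"
  assumes "x < y" "g x \<noteq> g y"
  shows "\<exists>i\<in>{x..<y}. g i \<noteq> g (i + 1)"
proof (rule ccontr)
  assume no: "\<not> ?thesis"
  have "g (x + d) = g x" if "x + d \<le> y" for d
    using that
  proof (induction d)
    case (Suc d)
    then have "g (x + d) = g (x + d + 1)" using no by (auto simp: Suc_le_eq)
    then show ?case using Suc by simp
  qed simp
  from this[of "y - x"] assms show False by simp
qed

lemma alternations_Suc:
  "x \<ge> 1 \<Longrightarrow> alternations (Suc x) g = alternations x g + (if g x \<noteq> g (Suc x) then 1 else 0)"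
proof -
  assume "x \<ge> 1"
  then have "{i \<in> {1..<Suc x}. g i \<noteq> g (i + 1)} =
      (if g x \<noteq> g (Suc x) then insert x {i \<in> {1..<x}. g i \<noteq> g (i + 1)}
       else {i \<in> {1..<x}. g i \<noteq> g (i + 1)})"
    by (auto simp: less_Suc_eq)
  then show ?thesis by (simp add: alternations_def)
qed

lemma alternations_1 [simp]: "alternations (Suc 0) g = 0"
  by (simp add: alternations_def)

text \<open>The \<open>r\<close> runs that end at an alternation are disjoint, so one of them has
  length at most \<open>n / r\<close>. Flipping it merges it with its neighbours: the alternation at
  its end disappears and no new one arises.\<close>

lemma flip_shortest_run:
  assumes r: "alternations n g = r" "r \<ge> 1"
  shows "\<exists>g'. alternations n g' < r \<and> r * card {x \<in> {1..n}. g x \<noteq> g' x} \<le> n"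
proof -
  define A where "A = {i \<in> {1..<n}. g i \<noteq> g (i + 1)}"
  have cA: "card A = r" and fA: "finite A" using r(1) by (auto simp: A_def alternations_def)
  \<comment> \<open>\<open>pr p\<close> is the preceding alternation, or 0 for the first run, so
    \<open>D p\<close> is exactly the run that ends at \<open>p\<close>.\<close>
  define pr where "pr p = Max (insert 0 {a \<in> A. a < p})" for p
  define D where "D p = {pr p<..p}" for p
  have pr_lt: "pr p < p" and pr_in: "pr p = 0 \<or> pr p \<in> A" if "p \<in> A" for p
  proof -
    have "pr p \<in> insert 0 {a \<in> A. a < p}"
      unfolding pr_def using fA by (intro Max_in) auto
    then show "pr p < p" "pr p = 0 \<or> pr p \<in> A" using that by (auto simp: A_def)
  qed
  have pr_ge: "a \<le> pr p" if "a \<in> A" "a < p" for a p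
    unfolding pr_def using that fA by (intro Max_ge) auto
  have "\<exists>p\<in>A. r * card (D p) \<le> n"
  proof (rule ccontr)
    assume "\<not> ?thesis"
    then have *: "\<And>p. p \<in> A \<Longrightarrow> n < r * card (D p)" by auto
    have "A \<noteq> {}" using cA r(2) by auto
    then have "(\<Sum>p\<in>A. n) < (\<Sum>p\<in>A. r * card (D p))"
      using * fA by (intro sum_strict_mono) auto
    moreover have "(\<Sum>p\<in>A. card (D p)) = card (\<Union>p\<in>A. D p)"
    proof (rule card_UN_disjoint[symmetric])
      show "\<forall>i\<in>A. \<forall>j\<in>A. i \<noteq> j \<longrightarrow> D i \<inter> D j = {}"
      proof (intro ballI impI)
        fix i j assume "i \<in> A" "j \<in> A" "i \<noteq> j"
        then show "D i \<inter> D j = {}" using pr_ge[of i j] pr_ge[of j i]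
          by (cases i j rule: linorder_cases) (auto simp: D_def)
      qed
    qed (auto simp: fA D_def)
    moreover have "card (\<Union>p\<in>A. D p) \<le> card {1..n}"
      by (intro card_mono) (auto simp: D_def A_def)
    ultimately have "r * n < r * n"
      using cA by (simp add: sum_distrib_left[symmetric])
    then show False by simp
  qed
  then obtain p where p: "p \<in> A" "r * card (D p) \<le> n" by auto
  define g' where "g' x = (if x \<in> D p then \<not> g x else g x)" for x
  have "{i \<in> {1..<n}. g' i \<noteq> g' (i + 1)} \<subseteq> A - {p}"
  proof
    fix i assume i: "i \<in> {i \<in> {1..<n}. g' i \<noteq> g' (i + 1)}"
    have mem: "i \<in> A" if "g i \<noteq> g (i + 1)" using i that by (simp add: A_def)
    have in_D: "x \<in> D p \<longleftrightarrow> pr p < x \<and> x \<le> p" for x by (simp add: D_def)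
    consider "i = p" | "i = pr p" "i \<noteq> p" | "i \<noteq> p" "i \<noteq> pr p" by blast
    then show "i \<in> A - {p}"
    proof cases
      case 1
      have "g p \<noteq> g (p + 1)" using p(1) by (simp add: A_def)
      then have False using i 1 pr_lt[OF p(1)] by (auto simp: g'_def in_D)
      then show ?thesis ..
    next
      case 2
      then have "i \<in> A" using pr_in[OF p(1)] i by auto
      then show ?thesis using 2 by auto
    next
      case 3
      have "i \<in> D p \<longleftrightarrow> i + 1 \<in> D p" using 3 by (auto simp: in_D)
      then have "g i \<noteq> g (i + 1)" using i by (auto simp: g'_def split: if_splits)
      then show ?thesis using mem 3 by auto
    qed
  qed
  then have "alternations n g' \<le> card (A - {p})"
    unfolding alternations_def using fA by (intro card_mono) auto
  also have "\<dots> < r" using cA p(1) fA r(2) by simp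
  finally have "alternations n g' < r" .
  moreover have "{x \<in> {1..n}. g x \<noteq> g' x} = D p"
    using p(1) by (auto simp: g'_def D_def A_def)
  ultimately show ?thesis using p(2) by (intro exI[of _ g']) simp
qed

lemma card_differences_triangle:
  "card {x \<in> {1..n::nat}. f x \<noteq> h x} \<le>
    card {x \<in> {1..n}. f x \<noteq> g x} + card {x \<in> {1..n}. g x \<noteq> h x}"
  by (rule order_trans[OF card_mono card_Un_le]) auto

text \<open>At most \<open>s\<close> flips are made, and each is applied while there are at least
  \<open>k\<close> alternations, hence changes at most \<open>n / k\<close> values.\<close>

lemma reduce_runs:
  assumes "alternations n g < k + s" "k \<ge> 1"
  shows "\<exists>g'. has_runs n k g' \<and> k * card {x \<in> {1..n}. g x \<noteq> g' x} \<le> s * n"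
  using assms(1)
proof (induction s arbitrary: g)
  case 0
  then show ?case by (intro exI[of _ g]) (simp add: has_runs_def)
next
  case (Suc s)
  show ?case
  proof (cases "alternations n g < k + s")
    case True
    from Suc.IH[OF True] obtain g' where
      "has_runs n k g'" "k * card {x \<in> {1..n}. g x \<noteq> g' x} \<le> s * n" by auto
    then show ?thesis by (intro exI[of _ g']) auto
  next
    case False
    then have *: "alternations n g = k + s" using Suc.prems by simp
    from flip_shortest_run[OF *] assms(2) obtain g1 where
      g1: "alternations n g1 < k + s" "(k + s) * card {x \<in> {1..n}. g x \<noteq> g1 x} \<le> n" by auto
    from Suc.IH[OF g1(1)] obtain g' where
      g': "has_runs n k g'" "k * card {x \<in> {1..n}. g1 x \<noteq> g' x} \<le> s * n" by auto
    have "k * card {x \<in> {1..n}. g x \<noteq> g1 x} \<le> n"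
      by (rule order_trans[OF _ g1(2)]) simp
    then have "k * (card {x \<in> {1..n}. g x \<noteq> g1 x} + card {x \<in> {1..n}. g1 x \<noteq> g' x}) \<le> Suc s * n"
      using g'(2) by (simp only: distrib_left mult_Suc add_mono)
    moreover have "k * card {x \<in> {1..n}. g x \<noteq> g' x} \<le>
        k * (card {x \<in> {1..n}. g x \<noteq> g1 x} + card {x \<in> {1..n}. g1 x \<noteq> g' x})"
      by (intro mult_le_mono2 card_differences_triangle)
    ultimately show ?thesis using g'(1) by (intro exI[of _ g']) linarith
  qed
qed

section \<open>Rounding window counts with hysteresis\<close>

text \<open>The last extreme value (\<open>\<le> T\<close> or \<open>\<ge> w - T\<close>) decides. The start value \<open>False\<close> is arbitrary and may
  cause one spurious alternation, whence the extra summand in \<open>alternations_hysteresis\<close>.\<close>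

primrec hysteresis :: "nat \<Rightarrow> nat \<Rightarrow> (nat \<Rightarrow> nat) \<Rightarrow> nat \<Rightarrow> bool" where
  "hysteresis T w a 0 = False"
| "hysteresis T w a (Suc x) =
    (if a (Suc x) \<le> T then False else if w - T \<le> a (Suc x) then True else hysteresis T w a x)"

text \<open>What one passage between the two extreme zones adds at least to the sum of
  \<open>a x * (w - a x)\<close>: steps of size at most 1 force a visit to every level strictly
  between the zones.\<close>

definition crossing_cost :: "nat \<Rightarrow> nat \<Rightarrow> nat"
  where "crossing_cost T w = (\<Sum>j\<in>{T<..<w - T}. j * (w - j))"

text \<open>An amortised count. Each alternation costs \<open>crossing_cost T w\<close> and is paid
  for by the levels visited since the previous extreme zone; different crossings use disjoint
  stretches of positions, so nothing is charged twice.\<close>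

lemma alternations_hysteresis:
  fixes a :: "nat \<Rightarrow> nat"
  assumes T: "2 * T < w"
    and lip: "\<And>x. \<lbrakk>1 \<le> x; x < N\<rbrakk> \<Longrightarrow> a (Suc x) \<le> Suc (a x) \<and> a x \<le> Suc (a (Suc x))"
    and N: "1 \<le> N"
  shows "alternations N (hysteresis T w a) * crossing_cost T w \<le>
    (\<Sum>x\<in>{1..N}. a x * (w - a x)) + crossing_cost T w"
proof -
  let ?g = "hysteresis T w a" and ?B = "crossing_cost T w" and ?b = "\<lambda>j. j * (w - j)"
  \<comment> \<open>the part of a crossing already paid for: a sequence with steps of size at most 1 cannot skip a level\<close>
  define \<Phi> where "\<Phi> s v = (\<Sum>j\<in>{j \<in> {T<..<w - T}. if s then v \<le> j else j \<le> v}. ?b j)" for s v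
  have side: "(?g (Suc x) \<longrightarrow> T < a (Suc x)) \<and> (\<not> ?g (Suc x) \<longrightarrow> a (Suc x) < w - T)" for x
    using T by auto
  have B_ge: "\<Phi> s v \<le> ?B" for s v
    unfolding \<Phi>_def crossing_cost_def by (intro sum_mono2) auto
  have "alternations x ?g * ?B + \<Phi> (?g x) (a x) \<le> (\<Sum>y\<in>{1..x}. ?b (a y)) + ?B"
    if "1 \<le> x" "x \<le> N" for x
    using that
  proof (induction x rule: dec_induct)
    case base
    show ?case using B_ge[of "?g 1" "a 1"] by simp
  next
    case (step x)
    let ?v = "a x" and ?v' = "a (Suc x)"
    have l: "?v' \<le> Suc ?v" "?v \<le> Suc ?v'" using lip[of x] step by auto
    have s: "?g x \<longrightarrow> T < ?v" "\<not> ?g x \<longrightarrow> ?v < w - T"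
      using side[of "x - 1"] step.hyps by auto
    have IH: "alternations x ?g * ?B + \<Phi> (?g x) ?v \<le> (\<Sum>y\<in>{1..x}. ?b (a y)) + ?B"
      using step by simp
    have sum: "(\<Sum>y\<in>{1..Suc x}. ?b (a y)) = (\<Sum>y\<in>{1..x}. ?b (a y)) + ?b ?v'"
      by simp
    have alt: "alternations (Suc x) ?g = alternations x ?g + (if ?g x \<noteq> ?g (Suc x) then 1 else 0)"
      using step by (intro alternations_Suc) auto
    \<comment> \<open>On entering an extreme zone the new potential is 0; if the output flips, the
      old potential was already all of \<open>?B\<close>, since \<open>?v\<close> was within one
      step of that zone. In the middle the potential can gain only the level \<open>?v'\<close>,
      which the new summand pays.\<close>
    consider (low) "?v' \<le> T" | (high) "w - T \<le> ?v'" | (mid) "T < ?v'" "?v' < w - T" by linarith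
    then have "(if ?g x \<noteq> ?g (Suc x) then 1 else 0) * ?B + \<Phi> (?g (Suc x)) ?v' \<le> \<Phi> (?g x) ?v + ?b ?v'"
    proof cases
      case low
      have 0: "\<Phi> False ?v' = 0" using low by (auto simp: \<Phi>_def intro!: sum.neutral)
      have "\<Phi> True ?v = ?B" if "?g x"
        unfolding \<Phi>_def crossing_cost_def using that low l s by (intro sum.cong) auto
      then show ?thesis using low 0 by auto
    next
      case high
      have 0: "\<Phi> True ?v' = 0" using high by (auto simp: \<Phi>_def intro!: sum.neutral)
      have "\<Phi> False ?v = ?B" if "\<not> ?g x"
        unfolding \<Phi>_def crossing_cost_def using that high l s by (intro sum.cong) auto
      then show ?thesis using high 0 T by auto
    next
      case mid
      then have g: "?g (Suc x) = ?g x" by simp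
      have "\<Phi> (?g x) ?v' \<le> (\<Sum>j\<in>insert ?v' {j \<in> {T<..<w - T}. if ?g x then ?v \<le> j else j \<le> ?v}. ?b j)"
        unfolding \<Phi>_def using l by (intro sum_mono2) auto
      also have "\<dots> \<le> \<Phi> (?g x) ?v + ?b ?v'"
        unfolding \<Phi>_def by (subst sum.insert_if) auto
      finally show ?thesis using g by simp
    qed
    then show ?case unfolding sum alt add_mult_distrib using IH by linarith
  qed
  from this[of N] N show ?thesis by simp
qed

text \<open>Cut the line into \<open>j\<close> blocks of length \<open>w\<close>. The part of
  \<open>Z\<close> in a block lies in the window of length \<open>w\<close> that starts at its least
  element.\<close>

lemma card_locally_sparse:
  fixes Z :: "nat set"
  assumes "\<And>z. z \<in> Z \<Longrightarrow> card (Z \<inter> {z..<z + w}) \<le> T"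
  shows "card (Z \<inter> {..<j * w}) \<le> j * T"
proof (induction j)
  case (Suc j)
  have "card (Z \<inter> {j * w..<j * w + w}) \<le> T"
  proof (cases "Z \<inter> {j * w..<j * w + w} = {}")
    case False
    define z where "z = Min (Z \<inter> {j * w..<j * w + w})"
    have z: "z \<in> Z \<inter> {j * w..<j * w + w}"
      unfolding z_def using False by (intro Min_in) auto
    have "Z \<inter> {j * w..<j * w + w} \<subseteq> Z \<inter> {z..<z + w}"
    proof
      fix y assume y: "y \<in> Z \<inter> {j * w..<j * w + w}"
      then have "z \<le> y" unfolding z_def by (intro Min_le) auto
      then show "y \<in> Z \<inter> {z..<z + w}" using y z by auto
    qed
    then have "card (Z \<inter> {j * w..<j * w + w}) \<le> card (Z \<inter> {z..<z + w})"
      by (intro card_mono) auto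
    then show ?thesis using assms[of z] z by simp
  qed simp
  moreover have "Z \<inter> {..<Suc j * w} = Z \<inter> {..<j * w} \<union> Z \<inter> {j * w..<j * w + w}" by auto
  ultimately show ?case
    using Suc card_Un_le[of "Z \<inter> {..<j * w}" "Z \<inter> {j * w..<j * w + w}"] by simp
qed simp

definition ones :: "(nat \<Rightarrow> bool) \<Rightarrow> nat \<Rightarrow> nat \<Rightarrow> nat"
  where "ones f w x = card {y \<in> {x..<x + w}. f y}"

lemma ones_Suc_bounds: "ones f w (Suc x) \<le> Suc (ones f w x) \<and> ones f w x \<le> Suc (ones f w (Suc x))"
proof
  have "ones f w (Suc x) \<le> card (insert (x + w) {y \<in> {x..<x + w}. f y})"
    unfolding ones_def by (intro card_mono) auto
  then show "ones f w (Suc x) \<le> Suc (ones f w x)"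
    by (simp add: ones_def card_insert_if split: if_splits)
  have "ones f w x \<le> card (insert x {y \<in> {Suc x..<Suc x + w}. f y})"
    unfolding ones_def by (intro card_mono) auto
  then show "ones f w x \<le> Suc (ones f w (Suc x))"
    by (simp add: ones_def card_insert_if split: if_splits)
qed

lemma card_zeros: "card {y \<in> {x..<x + w}. \<not> f y} = w - ones f w x"
proof -
  have "{y \<in> {x..<x + w}. \<not> f y} = {x..<x + w} - {y \<in> {x..<x + w}. f y}" by auto
  also have "card \<dots> = card {x..<x + w} - card {y \<in> {x..<x + w}. f y}"
    by (rule card_Diff_subset) auto
  finally show ?thesis by (simp add: ones_def)
qed

text \<open>The rounded function errs in three ways: at positions with a mixed window
  (\<open>m\<close> of them, each adding at least \<open>T * w / 2\<close> to \<open>S\<close>), at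
  minority values in nearly constant windows, and on the tail where no window fits.\<close>

lemma hysteresis_approximation:
  fixes f :: "nat \<Rightarrow> bool"
  assumes T: "2 * T + 2 \<le> w" and w: "w \<le> n"
  defines "S \<equiv> \<Sum>x\<in>{1..n + 1 - w}. ones f w x * (w - ones f w x)"
  shows "\<exists>g m. alternations n g * crossing_cost T w \<le> S + crossing_cost T w \<and>
    T * w * m \<le> 2 * S \<and>
    card {x \<in> {1..n}. f x \<noteq> g x} \<le> m + 2 * ((n div w + 1) * T) + w"
proof -
  define N where "N = n + 1 - w"
  have N: "1 \<le> N" "N \<le> n" using T w by (auto simp: N_def)
  let ?h = "hysteresis T w (ones f w)"
  \<comment> \<open>A window starting beyond \<open>N\<close> would leave \<open>{1..n}\<close>, so
    the value at \<open>N\<close> is kept from there on.\<close>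
  define g where "g x = ?h (min x N)" for x
  define M where "M = {x \<in> {1..N}. T < ones f w x \<and> ones f w x < w - T}"
  have "{i \<in> {1..<n}. g i \<noteq> g (i + 1)} \<subseteq> {i \<in> {1..<N}. ?h i \<noteq> ?h (i + 1)}"
  proof
    fix i assume i: "i \<in> {i \<in> {1..<n}. g i \<noteq> g (i + 1)}"
    have "i < N"
    proof (rule ccontr)
      assume "\<not> i < N"
      then have "min i N = N" "min (i + 1) N = N" by auto
      then show False using i by (simp only: g_def) simp
    qed
    then have "min i N = i" "min (i + 1) N = i + 1" by auto
    then show "i \<in> {i \<in> {1..<N}. ?h i \<noteq> ?h (i + 1)}"
      using i \<open>i < N\<close> by (simp only: g_def) simp
  qed
  then have "alternations n g \<le> alternations N ?h"
    unfolding alternations_def by (intro card_mono) auto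
  then have "alternations n g * crossing_cost T w \<le> alternations N ?h * crossing_cost T w"
    by simp
  also have "\<dots> \<le> S + crossing_cost T w"
    unfolding S_def N_def[symmetric] using T N ones_Suc_bounds
    by (intro alternations_hysteresis) auto
  finally have 1: "alternations n g * crossing_cost T w \<le> S + crossing_cost T w" .
  \<comment> \<open>Both factors exceed \<open>T\<close>, and the larger one is at least
    \<open>w / 2\<close>.\<close>
  have "T * w \<le> 2 * (j * (w - j))" if j: "T < j" "j < w - T" for j
  proof -
    define d e where "d = j - T - 1" and "e = w - j - T - 1"
    have d: "j = T + 1 + d" and e: "w = j + T + 1 + e" using j by (auto simp: d_def e_def)
    show ?thesis unfolding e d by (simp add: algebra_simps)
  qed
  then have "(\<Sum>x\<in>M. T * w) \<le> (\<Sum>x\<in>M. 2 * (ones f w x * (w - ones f w x)))"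
    by (intro sum_mono) (auto simp: M_def)
  also have "\<dots> \<le> (\<Sum>x\<in>{1..N}. 2 * (ones f w x * (w - ones f w x)))"
    by (intro sum_mono2) (auto simp: M_def)
  finally have 2: "T * w * card M \<le> 2 * S"
    by (simp add: S_def N_def sum_distrib_left mult.commute)
  \<comment> \<open>Minority values at extreme windows. The window starting at such a point contains
    at most \<open>T\<close> values of the same kind, which is the sparsity that
    \<open>card_locally_sparse\<close> asks for.\<close>
  define Z1 where "Z1 = {x \<in> {1..N}. f x \<and> ones f w x \<le> T}"
  define Z2 where "Z2 = {x \<in> {1..N}. \<not> f x \<and> w - T \<le> ones f w x}"
  have n_less: "n < (n div w + 1) * w"
    using dividend_less_div_times[of w n] T by simp
  have "card (Z1 \<inter> {z..<z + w}) \<le> T" if "z \<in> Z1" for z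
  proof -
    have "card (Z1 \<inter> {z..<z + w}) \<le> ones f w z"
      unfolding ones_def by (intro card_mono) (auto simp: Z1_def)
    then show ?thesis using that by (simp add: Z1_def)
  qed
  then have "card (Z1 \<inter> {..<(n div w + 1) * w}) \<le> (n div w + 1) * T"
    by (rule card_locally_sparse)
  moreover have "Z1 \<inter> {..<(n div w + 1) * w} = Z1"
    using n_less N by (auto simp: Z1_def)
  ultimately have c1: "card Z1 \<le> (n div w + 1) * T" by simp
  have "card (Z2 \<inter> {z..<z + w}) \<le> T" if "z \<in> Z2" for z
  proof -
    have "card (Z2 \<inter> {z..<z + w}) \<le> card {y \<in> {z..<z + w}. \<not> f y}"
      by (intro card_mono) (auto simp: Z2_def)
    also have "\<dots> = w - ones f w z" by (rule card_zeros)
    also have "\<dots> \<le> T" using that by (auto simp: Z2_def)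
    finally show ?thesis .
  qed
  then have "card (Z2 \<inter> {..<(n div w + 1) * w}) \<le> (n div w + 1) * T"
    by (rule card_locally_sparse)
  moreover have "Z2 \<inter> {..<(n div w + 1) * w} = Z2"
    using n_less N by (auto simp: Z2_def)
  ultimately have c2: "card Z2 \<le> (n div w + 1) * T" by simp
  have "{x \<in> {1..n}. f x \<noteq> g x} \<subseteq> M \<union> (Z1 \<union> Z2) \<union> {N<..n}"
  proof
    fix x assume x: "x \<in> {x \<in> {1..n}. f x \<noteq> g x}"
    show "x \<in> M \<union> (Z1 \<union> Z2) \<union> {N<..n}"
    proof (cases "x \<le> N")
      case True
      then obtain y where y: "x = Suc y" using x by (cases x) auto
      have "?h x \<noteq> f x" using True x by (simp add: g_def min_def)
      then show ?thesis using True x unfolding y M_def Z1_def Z2_def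
        by (auto split: if_splits simp: not_le)
    qed (use x in auto)
  qed
  then have "card {x \<in> {1..n}. f x \<noteq> g x} \<le> card (M \<union> (Z1 \<union> Z2) \<union> {N<..n})"
    by (intro card_mono) (auto simp: M_def Z1_def Z2_def)
  also have "\<dots> \<le> card M + (card Z1 + card Z2) + card {N<..n}"
    using card_Un_le[of "M \<union> (Z1 \<union> Z2)" "{N<..n}"] card_Un_le[of M "Z1 \<union> Z2"] card_Un_le[of Z1 Z2]
    by linarith
  also have "\<dots> \<le> card M + 2 * ((n div w + 1) * T) + w"
  proof -
    have "card {N<..n} \<le> w" using w by (simp add: N_def)
    then show ?thesis using c1 c2 by linarith
  qed
  finally show ?thesis using 1 2 by blast
qed

section \<open>Weighted disagreements\<close>

text \<open>The number of windows of length \<open>w\<close> that contain both \<open>x\<close> and \<open>y\<close>; the truncated subtraction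
  makes it vanish beyond distance \<open>w\<close>.\<close>

definition tent :: "nat \<Rightarrow> nat \<Rightarrow> nat \<Rightarrow> real"
  where "tent w x y = real (w - (max x y - min x y))"

text \<open>One-sided in \<open>f\<close>, so that the sum over ordered pairs counts each unordered
  disagreeing pair exactly once.\<close>

definition disagreement :: "nat \<Rightarrow> (nat \<Rightarrow> bool) \<Rightarrow> nat \<Rightarrow> nat \<Rightarrow> real"
  where "disagreement w f x y = (if f x \<and> \<not> f y then tent w x y else 0)"

lemma tent_commute: "tent w x y = tent w y x"
  by (simp add: tent_def max.commute min.commute)

lemma disagreement_nonneg: "0 \<le> disagreement w f x y"
  by (simp add: disagreement_def tent_def)

lemma disagreement_le_tent: "disagreement w f x y \<le> tent w x y"
  by (simp add: disagreement_def tent_def)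

lemma disagreement_le: "disagreement w f x y \<le> real w"
proof (rule order_trans[OF disagreement_le_tent])
  show "tent w x y \<le> real w" unfolding tent_def of_nat_le_iff by (rule diff_le_self)
qed

text \<open>Only about \<open>2 * w\<close> points lie within distance \<open>w\<close> of
  \<open>x\<close>, and each has weight at most \<open>w\<close>. Divided by \<open>n\<close>, this
  becomes the bound \<open>\<beta>\<close> of \<open>pair_sum_variance\<close>.\<close>

lemma sum_tent_row: "(\<Sum>y\<in>{1..n}. tent w x y) \<le> 2 * (real w)\<^sup>2"
proof -
  have "(\<Sum>y\<in>{1..n}. tent w x y) \<le> (\<Sum>y\<in>{1..n}. if y \<in> {x + 1 - w..<x + w} then real w else 0)"
    by (intro sum_mono) (auto simp: tent_def max_def min_def)
  also have "\<dots> = real (card ({1..n} \<inter> {x + 1 - w..<x + w})) * real w"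
    by (subst sum.inter_restrict[symmetric]) auto
  also have "\<dots> \<le> (2 * real w) * real w"
  proof (rule mult_right_mono)
    have "card ({1..n} \<inter> {x + 1 - w..<x + w}) \<le> card {x + 1 - w..<x + w}"
      by (intro card_mono) auto
    also have "\<dots> \<le> 2 * w" by (simp add: diff_le_mono)
    finally show "real (card ({1..n} \<inter> {x + 1 - w..<x + w})) \<le> 2 * real w" by simp
  qed simp
  finally show ?thesis by (simp add: power2_eq_square)
qed

lemma sum_disagreement_row: "(\<Sum>y\<in>{1..n}. disagreement w f x y) \<le> 2 * (real w)\<^sup>2"
  by (rule order_trans[OF sum_mono sum_tent_row]) (rule disagreement_le_tent)

lemma sum_disagreement_column: "(\<Sum>x\<in>{1..n}. disagreement w f x y) \<le> 2 * (real w)\<^sup>2"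
proof -
  have "disagreement w f x y \<le> tent w y x" for x
    by (subst tent_commute) (rule disagreement_le_tent)
  then show ?thesis by (intro order_trans[OF sum_mono sum_tent_row])
qed

section \<open>Total weight of the pairs that straddle a fixed alternation\<close>

lemma sum_descending: "(\<Sum>d<m. real (r - Suc d)) \<le> real r * (real r - 1) / 2"
proof (induction m arbitrary: r)
  case 0
  show ?case by (cases r) auto
next
  case (Suc m)
  show ?case
  proof (cases r)
    case (Suc s)
    have "(\<Sum>d<Suc m. real (r - Suc d)) = real s + (\<Sum>d<m. real (s - Suc d))"
      unfolding Suc by (subst sum.lessThan_Suc_shift) simp
    also have "\<dots> \<le> real s + real s * (real s - 1) / 2" using Suc.IH[of s] by simp
    also have "\<dots> = real r * (real r - 1) / 2" by (simp add: Suc field_simps)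
    finally show ?thesis .
  qed simp
qed

text \<open>A hockey-stick sum: the terms are the binomials \<open>w - u\<close> over 2, which add
  up to at most \<open>w + 1\<close> over 3. Truncated subtraction kills the terms with
  \<open>u \<ge> w\<close>, so the bound does not depend on \<open>m\<close>.\<close>

lemma sum_triangular:
  "(\<Sum>u<m. real (w - u) * (real (w - u) - 1) / 2) \<le> (real w ^ 3 - real w) / 6"
proof (induction m arbitrary: w)
  case 0
  have "real w \<le> real w ^ 3"
    by (cases "w = 0") (auto intro: self_le_power)
  then show ?case by simp
next
  case (Suc m)
  show ?case
  proof (cases w)
    case (Suc v)
    have "(\<Sum>u<Suc m. real (w - u) * (real (w - u) - 1) / 2) =
        real w * (real w - 1) / 2 + (\<Sum>u<m. real (v - u) * (real (v - u) - 1) / 2)"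
      unfolding Suc by (subst sum.lessThan_Suc_shift) simp
    also have "\<dots> \<le> real w * (real w - 1) / 2 + (real v ^ 3 - real v) / 6"
      using Suc.IH[of v] by simp
    also have "\<dots> = (real w ^ 3 - real w) / 6"
      by (simp add: Suc field_simps power3_eq_cube)
    finally show ?thesis .
  qed simp
qed

text \<open>With \<open>x = i - u\<close> and \<open>y = i + 1 + d\<close> the distance is
  \<open>u + d + 1\<close>, so the double sum becomes two nested descending sums.\<close>

lemma sum_tent_straddling:
  "(\<Sum>x\<in>{1..i}. \<Sum>y\<in>{i<..n}. tent w x y) \<le> real w ^ 3 / 6"
proof -
  have "(\<Sum>x\<in>{1..i}. \<Sum>y\<in>{i<..n}. tent w x y) =
      (\<Sum>u<i. \<Sum>y\<in>{i<..n}. tent w (i - u) y)"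
    by (rule sum.reindex_bij_witness[of _ "\<lambda>u. i - u" "\<lambda>x. i - x"]) auto
  also have "\<dots> = (\<Sum>u<i. \<Sum>d<n - i. real ((w - u) - Suc d))"
  proof (rule sum.cong[OF refl])
    fix u assume u: "u \<in> {..<i}"
    show "(\<Sum>y\<in>{i<..n}. tent w (i - u) y) = (\<Sum>d<n - i. real ((w - u) - Suc d))"
      by (rule sum.reindex_bij_witness[of _ "\<lambda>d. i + Suc d" "\<lambda>y. y - Suc i"])
        (use u in \<open>auto simp: tent_def max_def min_def\<close>)
  qed
  also have "\<dots> \<le> (\<Sum>u<i. real (w - u) * (real (w - u) - 1) / 2)"
    by (intro sum_mono sum_descending)
  also have "\<dots> \<le> (real w ^ 3 - real w) / 6" by (rule sum_triangular)
  also have "\<dots> \<le> real w ^ 3 / 6" by simp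
  finally show ?thesis .
qed

text \<open>Every disagreeing pair has an alternation between its two points. Charging the weight of
  the pair to all such alternations leaves at most \<open>w^3 / 6\<close> on each by
  \<open>sum_tent_straddling\<close>.\<close>

lemma sum_disagreement_upper:
  "(\<Sum>x\<in>{1..n}. \<Sum>y\<in>{1..n}. disagreement w f x y) \<le> real (alternations n f) * (real w ^ 3 / 6)"
proof -
  define A where "A = {i \<in> {1..<n}. f i \<noteq> f (i + 1)}"
  let ?d = "disagreement w f"
  \<comment> \<open>The diagonal vanishes, and the pairs with \<open>y < x\<close> are folded onto
    those with \<open>x < y\<close>; at most one of \<open>?d x y\<close> and \<open>?d y x\<close>
    is nonzero.\<close>
  have split: "?d x y = (if x < y then ?d x y else 0) + (if y < x then ?d x y else 0)" for x y
    by (auto simp: disagreement_def)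
  have "(\<Sum>x\<in>{1..n}. \<Sum>y\<in>{1..n}. ?d x y) =
      (\<Sum>x\<in>{1..n}. \<Sum>y\<in>{1..n}. if x < y then ?d x y else 0) +
      (\<Sum>x\<in>{1..n}. \<Sum>y\<in>{1..n}. if y < x then ?d x y else 0)"
    by (subst split) (simp only: sum.distrib)
  also have "(\<Sum>x\<in>{1..n}. \<Sum>y\<in>{1..n}. if y < x then ?d x y else 0) =
      (\<Sum>x\<in>{1..n}. \<Sum>y\<in>{1..n}. if x < y then ?d y x else 0)"
    by (rule sum.swap)
  also have "(\<Sum>x\<in>{1..n}. \<Sum>y\<in>{1..n}. if x < y then ?d x y else 0) + \<dots> =
      (\<Sum>x\<in>{1..n}. \<Sum>y\<in>{1..n}. if x < y then ?d x y + ?d y x else 0)"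
    by (simp only: sum.distrib[symmetric]) (intro sum.cong refl, simp)
  also have "\<dots> \<le> (\<Sum>x\<in>{1..n}. \<Sum>y\<in>{1..n}. \<Sum>i\<in>A. if x \<le> i \<and> i < y then tent w x y else 0)"
  proof (intro sum_mono)
    fix x y assume xy: "x \<in> {1..n}" "y \<in> {1..n}"
    have t0: "0 \<le> tent w x y" by (simp add: tent_def)
    show "(if x < y then ?d x y + ?d y x else 0) \<le>
        (\<Sum>i\<in>A. if x \<le> i \<and> i < y then tent w x y else 0)" (is "_ \<le> ?R")
    proof (cases "x < y \<and> f x \<noteq> f y")
      case True
      then obtain i where i: "i \<in> {x..<y}" "f i \<noteq> f (i + 1)"
        using alternation_between[of x y f] by blast
      then have iA: "i \<in> A" using xy by (auto simp: A_def)
      have "?d x y + ?d y x \<le> tent w x y"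
        using True by (auto simp: disagreement_def tent_commute)
      also have "\<dots> = (if x \<le> i \<and> i < y then tent w x y else 0)" using i by simp
      also have "\<dots> \<le> ?R"
        using iA t0 by (intro member_le_sum) (auto simp: A_def)
      finally show ?thesis using True by simp
    next
      case False
      then have "(if x < y then ?d x y + ?d y x else 0) = 0" by (auto simp: disagreement_def)
      also have "\<dots> \<le> ?R" using t0 by (intro sum_nonneg) auto
      finally show ?thesis .
    qed
  qed
  also have "\<dots> = (\<Sum>x\<in>{1..n}. \<Sum>i\<in>A. \<Sum>y\<in>{1..n}. if x \<le> i \<and> i < y then tent w x y else 0)"
    by (intro sum.cong refl sum.swap)
  also have "\<dots> = (\<Sum>i\<in>A. \<Sum>x\<in>{1..n}. \<Sum>y\<in>{1..n}. if x \<le> i \<and> i < y then tent w x y else 0)"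
    by (rule sum.swap)
  also have "\<dots> \<le> (\<Sum>i\<in>A. real w ^ 3 / 6)"
  proof (rule sum_mono)
    fix i assume "i \<in> A"
    then have i: "i < n" by (simp add: A_def)
    have "(\<Sum>x\<in>{1..n}. \<Sum>y\<in>{1..n}. if x \<le> i \<and> i < y then tent w x y else 0) =
        (\<Sum>x\<in>{1..n}. if x \<le> i then \<Sum>y\<in>{1..n}. if i < y then tent w x y else 0 else 0)"
      by (intro sum.cong refl) simp
    also have "\<dots> = (\<Sum>x\<in>{x \<in> {1..n}. x \<le> i}. \<Sum>y\<in>{y \<in> {1..n}. i < y}. tent w x y)"
      by (simp only: sum.inter_filter finite_atLeastAtMost)
    also have "{x \<in> {1..n}. x \<le> i} = {1..i}" using i by auto
    also have "{y \<in> {1..n}. i < y} = {i<..n}" by auto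
    also have "(\<Sum>x\<in>{1..i}. \<Sum>y\<in>{i<..n}. tent w x y) \<le> real w ^ 3 / 6"
      by (rule sum_tent_straddling)
    finally show "(\<Sum>x\<in>{1..n}. \<Sum>y\<in>{1..n}. if x \<le> i \<and> i < y then tent w x y else 0) \<le> real w ^ 3 / 6" .
  qed
  also have "\<dots> = real (alternations n f) * (real w ^ 3 / 6)"
    by (simp add: A_def alternations_def)
  finally show ?thesis .
qed

text \<open>Double counting: \<open>ones * (w - ones)\<close> is the number of disagreeing pairs
  inside a window, and a pair lies in at most \<open>tent w y z\<close> windows.\<close>

lemma sum_disagreement_lower:
  assumes "w \<le> n"
  shows "real (\<Sum>x\<in>{1..n + 1 - w}. ones f w x * (w - ones f w x)) \<le>
    (\<Sum>y\<in>{1..n}. \<Sum>z\<in>{1..n}. disagreement w f y z)"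
proof -
  let ?N = "n + 1 - w"
  have win: "{x..<x + w} \<subseteq> {1..n}" if "x \<in> {1..?N}" for x using that assms by auto
  have "real (\<Sum>x\<in>{1..?N}. ones f w x * (w - ones f w x)) =
      (\<Sum>x\<in>{1..?N}. \<Sum>y\<in>{1..n}. \<Sum>z\<in>{1..n}.
        if f y \<and> \<not> f z \<and> y \<in> {x..<x + w} \<and> z \<in> {x..<x + w} then 1 else 0)"
    unfolding of_nat_sum
  proof (rule sum.cong[OF refl])
    fix x assume x: "x \<in> {1..?N}"
    define Y where "Y = {y \<in> {x..<x + w}. f y}"
    define Z where "Z = {y \<in> {x..<x + w}. \<not> f y}"
    have "real (ones f w x * (w - ones f w x)) = (\<Sum>y\<in>Y. \<Sum>z\<in>Z. 1)"
    proof -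
      have "card Y = ones f w x" by (simp only: Y_def ones_def)
      moreover have "card Z = w - ones f w x" by (simp only: Z_def card_zeros)
      ultimately show ?thesis by simp
    qed
    also have "Y = {y \<in> {1..n}. f y \<and> y \<in> {x..<x + w}}" using win[OF x] by (auto simp: Y_def)
    also have "Z = {z \<in> {1..n}. \<not> f z \<and> z \<in> {x..<x + w}}" using win[OF x] by (auto simp: Z_def)
    also have "(\<Sum>y\<in>{y \<in> {1..n}. f y \<and> y \<in> {x..<x + w}}.
        \<Sum>z\<in>{z \<in> {1..n}. \<not> f z \<and> z \<in> {x..<x + w}}. 1) =
      (\<Sum>y\<in>{1..n}. if f y \<and> y \<in> {x..<x + w} then
        \<Sum>z\<in>{1..n}. if \<not> f z \<and> z \<in> {x..<x + w} then 1 else 0 else (0 :: real))"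
      by (simp only: sum.inter_filter finite_atLeastAtMost)
    also have "\<dots> = (\<Sum>y\<in>{1..n}. \<Sum>z\<in>{1..n}.
        if f y \<and> \<not> f z \<and> y \<in> {x..<x + w} \<and> z \<in> {x..<x + w} then 1 else 0)"
      by (rule sum.cong[OF refl]) (auto intro!: sum.cong sum.neutral)
    finally show "real (ones f w x * (w - ones f w x)) = (\<Sum>y\<in>{1..n}. \<Sum>z\<in>{1..n}.
        if f y \<and> \<not> f z \<and> y \<in> {x..<x + w} \<and> z \<in> {x..<x + w} then 1 else 0)" .
  qed
  also have "\<dots> = (\<Sum>y\<in>{1..n}. \<Sum>x\<in>{1..?N}. \<Sum>z\<in>{1..n}.
        if f y \<and> \<not> f z \<and> y \<in> {x..<x + w} \<and> z \<in> {x..<x + w} then 1 else 0)"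
    by (rule sum.swap)
  also have "\<dots> = (\<Sum>y\<in>{1..n}. \<Sum>z\<in>{1..n}. \<Sum>x\<in>{1..?N}.
        if f y \<and> \<not> f z \<and> y \<in> {x..<x + w} \<and> z \<in> {x..<x + w} then 1 else 0)"
    by (intro sum.cong refl sum.swap)
  also have "\<dots> \<le> (\<Sum>y\<in>{1..n}. \<Sum>z\<in>{1..n}. disagreement w f y z)"
  proof (intro sum_mono)
    fix y z
    have "(\<Sum>x\<in>{1..?N}. if y \<in> {x..<x + w} \<and> z \<in> {x..<x + w} then 1 else (0::real)) =
        real (card {x \<in> {1..?N}. y \<in> {x..<x + w} \<and> z \<in> {x..<x + w}})"
      by (subst sum.inter_filter[symmetric]) auto
    also have "\<dots> \<le> real (card {max y z + 1 - w..min y z})"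
      by (intro of_nat_mono card_mono) auto
    also have "\<dots> \<le> tent w y z" unfolding tent_def by (intro of_nat_mono) auto
    finally have "(\<Sum>x\<in>{1..?N}. if y \<in> {x..<x + w} \<and> z \<in> {x..<x + w} then 1 else 0) \<le> tent w y z" .
    then show "(\<Sum>x\<in>{1..?N}. if f y \<and> \<not> f z \<and> y \<in> {x..<x + w} \<and> z \<in> {x..<x + w} then 1 else 0)
        \<le> disagreement w f y z"
      by (cases "f y \<and> \<not> f z") (auto simp: disagreement_def)
  qed
  finally show ?thesis .
qed

section \<open>The collision tester\<close>

lemma far_from_has_runsD:
  assumes "far_from n (has_runs n k) \<epsilon> f" "alternations n g < k" "n \<ge> 1"
  shows "real (card {x \<in> {1..n}. f x \<noteq> g x}) \<ge> \<epsilon> * real n"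
proof -
  have "has_runs n k g" using assms(2) by (simp add: has_runs_def)
  then have "real (card {x \<in> {1..n}. f x \<noteq> g x}) / real n \<ge> \<epsilon>"
    using assms(1) unfolding far_from_def by blast
  moreover have "real n > 0" using assms(3) by simp
  ultimately show ?thesis by (simp only: pos_le_divide_eq)
qed

section \<open>The gap in weighted disagreements between few runs and far functions\<close>

lemma sum_products_atMost:
  "(\<Sum>j\<le>m. real j * (c - real j)) = c * real m * (real m + 1) / 2 - real m * (real m + 1) * (2 * real m + 1) / 6"
  by (induction m) (simp_all add: field_simps)

text \<open>For \<open>T = 0\<close> the cost is exactly \<open>(w^3 - w) / 6\<close>. Raising
  \<open>T\<close> to \<open>T + 1\<close> drops at most the two levels \<open>T + 1\<close> and
  \<open>w - (T + 1)\<close>, each worth at most \<open>(T + 1) * w\<close>.\<close>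

lemma crossing_cost_ge:
  assumes "2 * T < w"
  shows "real w ^ 3 / 6 \<le> real (crossing_cost T w) + real w / 6 + real w * real T * (real T + 1)"
  using assms
proof (induction T)
  case 0
  have "real (crossing_cost 0 w) = (\<Sum>j\<in>{0<..<w}. real j * (real w - real j))"
    unfolding crossing_cost_def of_nat_sum by (intro sum.cong) (auto simp: of_nat_diff)
  also have "\<dots> = (\<Sum>j\<le>w. real j * (real w - real j))"
    by (intro sum.mono_neutral_left) (auto simp: le_less)
  also have "\<dots> = real w * real w * (real w + 1) / 2 - real w * (real w + 1) * (2 * real w + 1) / 6"
    by (rule sum_products_atMost)
  finally show ?case by (simp add: field_simps power3_eq_cube)
next
  case (Suc T)
  have "crossing_cost T w \<le>
      (\<Sum>j\<in>{Suc T<..<w - Suc T} \<union> {Suc T, w - Suc T}. j * (w - j))"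
    unfolding crossing_cost_def by (intro sum_mono2) auto
  also have "\<dots> \<le> crossing_cost (Suc T) w + (\<Sum>j\<in>{Suc T, w - Suc T}. j * (w - j))"
  proof -
    have "sum g (A \<union> B) \<le> sum g A + sum g B" if "finite A" "finite B" for g :: "nat \<Rightarrow> nat" and A B
      using sum.union_inter[OF that, of g] by linarith
    then show ?thesis unfolding crossing_cost_def by (meson finite.emptyI finite.insertI finite_greaterThanLessThan)
  qed
  also have "(\<Sum>j\<in>{Suc T, w - Suc T}. j * (w - j)) \<le> 2 * (Suc T * w)"
  proof -
    have 1: "Suc T * (w - Suc T) \<le> Suc T * w" by (rule mult_le_mono2) simp
    have "w - (w - Suc T) = Suc T" using Suc.prems by simp
    then have "(w - Suc T) * (w - (w - Suc T)) \<le> Suc T * w" using 1 by (simp only: mult.commute)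
    then show ?thesis using 1 by (auto simp: sum.insert_if)
  qed
  finally have "real (crossing_cost T w) \<le> real (crossing_cost (Suc T) w + 2 * (Suc T * w))"
    by (intro of_nat_mono) simp
  then have "real (crossing_cost T w) \<le> real (crossing_cost (Suc T) w) + 2 * (real T + 1) * real w"
    by (simp add: algebra_simps)
  moreover have "real w ^ 3 / 6 \<le> real (crossing_cost T w) + real w / 6 + real w * real T * (real T + 1)"
    using Suc by simp
  ultimately show ?case by (simp add: algebra_simps)
qed

text \<open>If the sum were smaller, hysteresis rounding followed by run flips would give a function
  with \<open>k\<close> runs closer than \<open>\<epsilon>\<close>. Here \<open>k8\<close> absorbs
  additive losses in the run count, \<open>w_le\<close> keeps the mixed windows and the tail rare,
  and \<open>w_ge\<close> makes the rounding of \<open>T\<close> and the lower-order terms of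
  \<open>crossing_cost\<close> negligible.\<close>

lemma far_from_window_gap:
  fixes n k w :: nat and \<epsilon> :: real
  assumes n: "n \<ge> 1" and k: "k \<ge> 1" and \<epsilon>: "0 < \<epsilon>" "\<epsilon> \<le> 1"
    and k8: "8 \<le> real k * \<epsilon>"
    and w_le: "64 * real k * real w \<le> \<epsilon>\<^sup>2 * real n"
    and w_ge: "256 \<le> real w * \<epsilon>\<^sup>2"
    and far: "far_from n (has_runs n k) \<epsilon> f"
  shows "(1 + \<epsilon> / 8) * (real k * real w ^ 3 / 6) \<le>
    real (\<Sum>x\<in>{1..n + 1 - w}. ones f w x * (w - ones f w x))" (is "_ \<le> real ?S")
proof (rule ccontr)
  assume "\<not> ?thesis"
  then have S: "real ?S < (1 + \<epsilon> / 8) * (real k * real w ^ 3 / 6)" by simp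
  define W N K where "W = real w" and "N = real n" and "K = real k"
  have K1: "1 \<le> K" and N1: "1 \<le> N" using k n by (auto simp: K_def N_def)
  have e2: "\<epsilon>\<^sup>2 \<le> \<epsilon>" using \<epsilon> by (simp add: power2_eq_square mult_left_le)
  have W_nonneg: "0 \<le> W" by (simp add: W_def)
  have "W * \<epsilon>\<^sup>2 \<le> W * \<epsilon>" using e2 W_nonneg by (rule mult_left_mono)
  then have We: "256 \<le> W * \<epsilon>" using w_ge by (simp add: W_def)
  have "W * \<epsilon> \<le> W" using \<epsilon> W_nonneg by (simp add: mult_left_le)
  then have W256: "256 \<le> W" using We by simp
  have KW: "64 * (K * W) \<le> \<epsilon>\<^sup>2 * N" using w_le by (simp add: K_def W_def N_def)
  have "1 * W \<le> K * W" using K1 W_nonneg by (intro mult_right_mono)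
  moreover have "\<epsilon>\<^sup>2 * N \<le> \<epsilon> * N" using e2 N1 by (intro mult_right_mono) auto
  moreover have eN: "\<epsilon> * N \<le> N" using \<epsilon> N1 by simp
  ultimately have W_eN: "64 * W \<le> \<epsilon> * N" using KW by linarith
  have wn: "w \<le> n"
  proof -
    have "W \<le> N" using W_eN eN W_nonneg by linarith
    then show ?thesis by (simp add: W_def N_def)
  qed
  \<comment> \<open>With about \<open>\<epsilon> / 16\<close> of a window as threshold, minority
    values cost about \<open>\<epsilon> * n / 8\<close> changes, while the crossing cost loses only
    a relative \<open>\<epsilon> / 16\<close>.\<close>
  define T where "T = nat \<lfloor>\<epsilon> * W / 16\<rfloor>"
  define R where "R = real T"
  have R_le: "R \<le> \<epsilon> * W / 16" and R_gt: "\<epsilon> * W / 16 - 1 < R"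
  proof -
    have "0 \<le> \<epsilon> * W / 16" using \<epsilon> W_nonneg by simp
    then show "R \<le> \<epsilon> * W / 16" "\<epsilon> * W / 16 - 1 < R" unfolding R_def T_def by linarith+
  qed
  have R_ge: "\<epsilon> * W / 32 \<le> R" using R_gt We by (simp add: mult.commute)
  have R1: "1 \<le> R" using R_ge We by (simp add: mult.commute)
  have "2 * R + 2 \<le> W" using R_le \<open>W * \<epsilon> \<le> W\<close> W256 mult.commute[of \<epsilon> W] by linarith
  then have Tw: "2 * T + 2 \<le> w" unfolding R_def W_def by linarith
  define B where "B = real (crossing_cost T w)"
  have B_ge: "(1 - \<epsilon> / 16) * (W ^ 3 / 6) \<le> B"
  proof -
    have "W ^ 3 / 6 \<le> B + W / 6 + W * R * (R + 1)"
      unfolding B_def W_def R_def using Tw by (intro crossing_cost_ge) auto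
    moreover have "W / 6 + W * R * (R + 1) \<le> \<epsilon> / 16 * (W ^ 3 / 6)"
    proof -
      have "R * (R + 1) \<le> R * (2 * R)" using R1 by (intro mult_left_mono) auto
      also have "\<dots> = 2 * R\<^sup>2" by (simp add: power2_eq_square)
      also have "\<dots> \<le> 2 * (\<epsilon> * W / 16)\<^sup>2" using R_le R1 by (intro mult_left_mono power_mono) auto
      also have "\<dots> = \<epsilon>\<^sup>2 * (W\<^sup>2 / 128)" by (simp add: power_mult_distrib power_divide)
      also have "\<dots> \<le> \<epsilon> * (W\<^sup>2 / 128)" using e2 by (intro mult_right_mono) auto
      finally have 1: "R * (R + 1) \<le> \<epsilon> * W\<^sup>2 / 128" by simp
      have "256 * 256 \<le> (W * \<epsilon>) * W" using We W256 by (intro mult_mono) auto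
      then have 2: "1 / 6 \<le> \<epsilon> * W\<^sup>2 / 384" by (simp add: power2_eq_square mult_ac)
      have "1 / 6 + R * (R + 1) \<le> \<epsilon> * W\<^sup>2 / 96" using 1 2 by simp
      then have "W * (1 / 6 + R * (R + 1)) \<le> W * (\<epsilon> * W\<^sup>2 / 96)" using W_nonneg by (rule mult_left_mono)
      then show ?thesis by (simp add: algebra_simps power2_eq_square power3_eq_cube)
    qed
    ultimately show ?thesis by (simp add: algebra_simps)
  qed
  have W3: "0 < W ^ 3" using W256 by simp
  have "(15 / 16) * (W ^ 3 / 6) \<le> (1 - \<epsilon> / 16) * (W ^ 3 / 6)"
    using \<epsilon> W3 by (intro mult_right_mono) auto
  then have B_pos: "0 < B" using B_ge W3 by linarith
  obtain g m where g: "alternations n g * crossing_cost T w \<le> ?S + crossing_cost T w"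
    and m: "T * w * m \<le> 2 * ?S"
    and fg: "card {x \<in> {1..n}. f x \<noteq> g x} \<le> m + 2 * ((n div w + 1) * T) + w"
    using hysteresis_approximation[OF Tw wn, of f] by blast
  define a where "a = real (alternations n g)"
  have aB: "(a - 1) * B \<le> real ?S"
  proof -
    have "real (alternations n g * crossing_cost T w) \<le> real (?S + crossing_cost T w)"
      using g by (rule of_nat_mono)
    then show ?thesis by (simp only: of_nat_mult of_nat_add a_def B_def) (simp add: algebra_simps)
  qed
  \<comment> \<open>More alternations would force a larger sum, because \<open>(1 + \<epsilon> / 4)
    * (1 - \<epsilon> / 16) \<ge> 1 + \<epsilon> / 8\<close>.\<close>
  have a_le: "a \<le> 1 + K + K * \<epsilon> / 4"
  proof (rule ccontr)
    assume "\<not> ?thesis"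
    then have a: "K * (1 + \<epsilon> / 4) \<le> a - 1" by (simp add: algebra_simps)
    moreover have "0 \<le> K * (1 + \<epsilon> / 4)" using K1 \<epsilon> by simp
    ultimately have "0 \<le> a - 1" by linarith
    then have "K * (1 + \<epsilon> / 4) * ((1 - \<epsilon> / 16) * (W ^ 3 / 6)) \<le> (a - 1) * B"
      using a B_ge \<epsilon> W3 by (intro mult_mono mult_nonneg_nonneg) auto
    moreover have "(1 + \<epsilon> / 8) * (K * W ^ 3 / 6) \<le> K * (1 + \<epsilon> / 4) * ((1 - \<epsilon> / 16) * (W ^ 3 / 6))"
    proof -
      have "(1 + \<epsilon> / 4) * (1 - \<epsilon> / 16) = 1 + 3 * \<epsilon> / 16 - \<epsilon>\<^sup>2 / 64"
        by (simp add: field_simps power2_eq_square)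
      then have "1 + \<epsilon> / 8 \<le> (1 + \<epsilon> / 4) * (1 - \<epsilon> / 16)" using e2 \<epsilon> by linarith
      then have "(1 + \<epsilon> / 8) * (K * W ^ 3 / 6) \<le> ((1 + \<epsilon> / 4) * (1 - \<epsilon> / 16)) * (K * W ^ 3 / 6)"
        using K1 W3 by (intro mult_right_mono) auto
      then show ?thesis by (simp add: mult_ac)
    qed
    ultimately show False using aB S by (simp add: K_def W_def)
  qed
  \<comment> \<open>The excess is at most \<open>2 + K * \<epsilon> / 4\<close>: one unit for the
    spurious first alternation, one because \<open>k\<close> runs allow only \<open>k - 1\<close>
    alternations. By \<open>k8\<close> these two units are at most
    \<open>K * \<epsilon> / 4\<close>.\<close>
  define s where "s = alternations n g + 1 - k"
  have s_le: "real s \<le> K * \<epsilon> / 2"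
  proof -
    have "real s \<le> max 0 (a + 1 - K)" by (auto simp: s_def a_def K_def of_nat_diff max_def)
    then show ?thesis using a_le k8 by (simp add: K_def max_def split: if_splits)
  qed
  have "alternations n g < k + s" by (simp add: s_def)
  then obtain g' where g': "has_runs n k g'" "k * card {x \<in> {1..n}. g x \<noteq> g' x} \<le> s * n"
    using reduce_runs[OF _ k] by blast
  have gg': "real (card {x \<in> {1..n}. g x \<noteq> g' x}) \<le> \<epsilon> * N / 2" (is "?d \<le> _")
  proof -
    have "real (k * card {x \<in> {1..n}. g x \<noteq> g' x}) \<le> real (s * n)" using g'(2) by (rule of_nat_mono)
    then have "K * ?d \<le> real s * N" by (simp only: of_nat_mult K_def N_def)
    also have "\<dots> \<le> (K * \<epsilon> / 2) * N" using s_le N1 by (intro mult_right_mono) auto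
    also have "\<dots> = K * (\<epsilon> * N / 2)" by simp
    finally show ?thesis using K1 by simp
  qed
  have m_le: "real m \<le> 12 / 64 * (\<epsilon> * N)"
  proof -
    have "real (T * w * m) \<le> real (2 * ?S)" using m by (rule of_nat_mono)
    then have "R * W * real m \<le> 2 * real ?S" by (simp only: of_nat_mult R_def W_def)
    also have "\<dots> \<le> 2 * ((9 / 8) * (K * W ^ 3 / 6))"
    proof -
      have "(1 + \<epsilon> / 8) * (K * W ^ 3 / 6) \<le> (9 / 8) * (K * W ^ 3 / 6)"
        using \<epsilon> K1 W3 by (intro mult_right_mono) auto
      then show ?thesis using S unfolding K_def W_def by linarith
    qed
    finally have "R * W * real m \<le> 3 / 8 * K * W ^ 3" by simp
    moreover have "(\<epsilon> * W / 32) * W * real m \<le> R * W * real m"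
      using R_ge W_nonneg by (intro mult_right_mono) auto
    ultimately have "W\<^sup>2 * (\<epsilon> * real m) \<le> W\<^sup>2 * (12 * (K * W))"
      by (simp add: power2_eq_square power3_eq_cube algebra_simps)
    then have "\<epsilon> * real m \<le> 12 * (K * W)" using W256 by simp
    also have "\<dots> \<le> \<epsilon> * (12 / 64 * (\<epsilon> * N))" using KW by (simp add: power2_eq_square mult_ac)
    finally show ?thesis using \<epsilon> by simp
  qed
  have div_le: "real (2 * ((n div w + 1) * T)) \<le> (N + W) * \<epsilon> / 8"
  proof -
    have "real (n div w) \<le> N / W" unfolding N_def W_def by (rule of_nat_div_le_of_nat)
    then have "(real (n div w) + 1) * R \<le> (N / W + 1) * (\<epsilon> * W / 16)"
      using R_le R1 W256 N1 by (intro mult_mono) auto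
    also have "\<dots> = (N + W) * \<epsilon> / 16" using W256 by (simp add: field_simps)
    finally show ?thesis by (simp add: R_def algebra_simps)
  qed
  \<comment> \<open>Budget as fractions of \<open>\<epsilon> * N\<close>: 12/64 for mixed windows,
    slightly over 1/8 for minority values, 1/64 for the tail and 1/2 for run flips, in total below
    1.\<close>
  have "\<epsilon> * N \<le> real (card {x \<in> {1..n}. f x \<noteq> g' x})"
    unfolding N_def using g'(1) n
    by (intro far_from_has_runsD[OF far]) (simp_all add: has_runs_def)
  also have "\<dots> \<le> real (card {x \<in> {1..n}. f x \<noteq> g x}) + ?d"
    using of_nat_mono[OF card_differences_triangle[of n f g' g], where 'a = real] by (simp only: of_nat_add)
  also have "\<dots> \<le> real (m + 2 * ((n div w + 1) * T) + w) + \<epsilon> * N / 2"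
    using of_nat_mono[OF fg] gg' by (intro add_mono)
  also have "\<dots> = real m + real (2 * ((n div w + 1) * T)) + W + \<epsilon> * N / 2"
    by (simp only: of_nat_add W_def)
  also have "\<dots> \<le> 12 / 64 * (\<epsilon> * N) + (N + W) * \<epsilon> / 8 + \<epsilon> * N / 64 + \<epsilon> * N / 2"
    using m_le div_le W_eN by linarith
  also have "\<dots> < \<epsilon> * N"
  proof -
    have "W * \<epsilon> \<le> \<epsilon> * N / 64" using \<open>W * \<epsilon> \<le> W\<close> W_eN by linarith
    moreover have "0 < \<epsilon> * N" using \<epsilon> N1 by simp
    moreover have "(N + W) * \<epsilon> / 8 = \<epsilon> * N / 8 + W * \<epsilon> / 8" by (simp add: field_simps)
    ultimately show ?thesis by linarith
  qed
  finally show False by simp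
qed

section \<open>Concentration of the collision estimate\<close>

definition labelled_disagreement :: "nat \<Rightarrow> nat \<times> bool \<Rightarrow> nat \<times> bool \<Rightarrow> real"
  where "labelled_disagreement w p r = (if snd p \<and> \<not> snd r then tent w (fst p) (fst r) else 0)"

lemma pair_sum_labelled:
  "pair_sum (labelled_disagreement w) q (map (\<lambda>x. (x, f x)) xs) = pair_sum (disagreement w f) q xs"
  by (simp add: pair_sum_def take_map drop_map o_def labelled_disagreement_def disagreement_def
      cong: if_cong)

text \<open>The statistic has mean \<open>c * H f\<close> with \<open>c = q^2 / n^2\<close>. The
  threshold \<open>(1 + \<epsilon> / 16) * H0\<close> separates \<open>H f \<le> H0\<close> (at most
  \<open>k\<close> runs) from \<open>H f \<ge> (1 + \<epsilon> / 8) * H0\<close> (far). The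
  sample-size condition is the resulting Chebyshev requirement; in \<open>5832 = 6 * 972\<close> the
  6 comes from \<open>w^3 / 6\<close>.\<close>

lemma collision_tester:
  fixes n k w q :: nat and \<epsilon> :: real
  assumes n: "n \<ge> 1" and k: "k \<ge> 1" and w: "1 \<le> w" "w \<le> n" and q1: "1 \<le> q" and \<epsilon>: "0 < \<epsilon>" "\<epsilon> \<le> 1"
    and q: "5832 * ((real n)\<^sup>2 + 4 * real q * real w * real n) \<le> (real q)\<^sup>2 * \<epsilon>\<^sup>2 * real k * (real w)\<^sup>2"
    and gap: "\<And>f. far_from n (has_runs n k) \<epsilon> f \<Longrightarrow>
      (1 + \<epsilon> / 8) * (real k * real w ^ 3 / 6) \<le>
        real (\<Sum>x\<in>{1..n + 1 - w}. ones f w x * (w - ones f w x))"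
  shows "is_tester n (has_runs n k) \<epsilon> (q + q) (\<lambda>s. return_pmf
    (pair_sum (labelled_disagreement w) q s \<le>
      (real q)\<^sup>2 / (real n)\<^sup>2 * ((1 + \<epsilon> / 16) * (real k * real w ^ 3 / 6))))"
proof -
  define H0 where "H0 = real k * real w ^ 3 / 6"
  define c where "c = (real q)\<^sup>2 / (real n)\<^sup>2"
  define H where "H f = (\<Sum>x\<in>{1..n}. \<Sum>y\<in>{1..n}. disagreement w f x y)" for f
  have H0_pos: "0 < H0" using k w by (simp add: H0_def)
  have c_pos: "0 < c" using n q1 by (simp add: c_def)
  have npos: "0 < real n" using n by simp
  have wpos: "0 < real w" using w by simp
  \<comment> \<open>\<open>X\<close> stands for the larger of \<open>H0\<close> and
    \<open>H f\<close>: it is \<open>H0\<close> for functions with \<open>k\<close> runs and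
    \<open>H f\<close> for far ones. The variance grows linearly in \<open>X\<close> and the squared
    deviation quadratically, so \<open>X \<ge> H0\<close> is the critical bound.\<close>
  have count: "3 * real (card {zs \<in> samples {1..n} (q + q). P zs}) \<le> real n ^ (q + q)"
    if H: "0 < X" "H f \<le> X" "H0 \<le> X" and t: "\<epsilon> / 18 * X \<le> t"
      and P: "\<And>zs. P zs \<Longrightarrow> c * t \<le> \<bar>pair_sum (disagreement w f) q zs - c * H f\<bar>"
    for f P X t
  proof -
    let ?A = "{1..n}" and ?h = "disagreement w f"
    have A: "finite ?A" "?A \<noteq> {}" using n by auto
    have mu: "avg ?A (\<lambda>x. avg ?A (\<lambda>y. ?h x y)) = H f / (real n)\<^sup>2"
      by (simp add: avg_def H_def sum_divide_distrib[symmetric] power2_eq_square)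
    have row: "avg ?A (\<lambda>y. ?h x y) \<le> 2 * (real w)\<^sup>2 / real n" for x
      using divide_right_mono[OF sum_disagreement_row[where n=n and w=w and f=f and x=x], of "real n"]
      by (simp add: avg_def)
    have col: "avg ?A (\<lambda>x. ?h x y) \<le> 2 * (real w)\<^sup>2 / real n" for y
      using divide_right_mono[OF sum_disagreement_column[where n=n and w=w and f=f and y=y], of "real n"]
      by (simp add: avg_def)
    define V where "V = ((real q)\<^sup>2 * real w + 4 * real q ^ 3 * (real w)\<^sup>2 / real n) / (real n)\<^sup>2"
    have V0: "0 \<le> V" by (simp add: V_def)
    have "avg (samples ?A (q + q)) (\<lambda>zs. (pair_sum ?h q zs - (real q)\<^sup>2 * (H f / (real n)\<^sup>2))\<^sup>2) \<le>
      (real q)\<^sup>2 * real w * (H f / (real n)\<^sup>2) +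
        2 * real q ^ 3 * (2 * (real w)\<^sup>2 / real n) * (H f / (real n)\<^sup>2)"
      unfolding mu[symmetric]
      by (rule pair_sum_variance[OF A disagreement_nonneg disagreement_le row col])
    also have "\<dots> = V * H f" by (simp add: V_def add_divide_distrib distrib_left mult_ac)
    also have "\<dots> \<le> V * X" using H(2) V0 by (rule mult_left_mono)
    finally have var: "avg (samples ?A (q + q)) (\<lambda>zs. (pair_sum ?h q zs - c * H f)\<^sup>2) \<le> V * X"
      by (simp add: c_def)
    have t_pos: "0 < t"
    proof -
      have "0 < \<epsilon> / 18 * X" using H(1) \<epsilon> by simp
      then show ?thesis using t by simp
    qed
    then have ct: "0 < c * t" using c_pos by simp
    have fin: "finite (samples ?A (q + q))" by (rule finite_lists_length_eq) simp
    have "real (card {zs \<in> samples ?A (q + q). P zs}) * (c * t)\<^sup>2 \<le>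
        V * X * real (card (samples ?A (q + q)))"
      by (rule chebyshev_count[OF fin ct var]) (rule P)
    also have "real (card (samples ?A (q + q))) = real n ^ (q + q)"
      by (simp add: card_lists_length_eq)
    finally have ch: "real (card {zs \<in> samples ?A (q + q). P zs}) * (c * t)\<^sup>2 \<le> V * X * real n ^ (q + q)" .
    have "3 * (V * X) \<le> (c * t)\<^sup>2"
    proof -
      \<comment> \<open>\<open>972 = 3 * 18\<^sup>2\<close>: error probability \<open>1 / 3\<close> at relative deviation \<open>\<epsilon> / 18\<close>\<close>
      have "972 * V \<le> c\<^sup>2 * \<epsilon>\<^sup>2 * H0"
      proof -
        have "972 * V = 5832 * ((real n)\<^sup>2 + 4 * real q * real w * real n) *
            ((real q)\<^sup>2 * real w / (6 * real n ^ 4))"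
          using npos by (simp add: V_def field_simps power2_eq_square power3_eq_cube power4_eq_xxxx)
        also have "\<dots> \<le> ((real q)\<^sup>2 * \<epsilon>\<^sup>2 * real k * (real w)\<^sup>2) * ((real q)\<^sup>2 * real w / (6 * real n ^ 4))"
          using q by (rule mult_right_mono) simp
        also have "\<dots> = c\<^sup>2 * \<epsilon>\<^sup>2 * H0"
          using npos by (simp add: c_def H0_def field_simps power2_eq_square power3_eq_cube power4_eq_xxxx)
        finally show ?thesis .
      qed
      also have "\<dots> \<le> c\<^sup>2 * \<epsilon>\<^sup>2 * X" using H(3) by (intro mult_left_mono) auto
      finally have "972 * V * X \<le> c\<^sup>2 * \<epsilon>\<^sup>2 * X * X" using H(1) by (intro mult_right_mono) auto
      then have "3 * (V * X) \<le> (c * (\<epsilon> / 18 * X))\<^sup>2"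
        by (simp add: power_mult_distrib power2_eq_square field_simps)
      also have "\<dots> \<le> (c * t)\<^sup>2"
        using t c_pos H(1) \<epsilon> by (intro power_mono mult_left_mono) auto
      finally show ?thesis .
    qed
    then have "3 * (V * X) * real n ^ (q + q) \<le> (c * t)\<^sup>2 * real n ^ (q + q)"
      by (rule mult_right_mono) simp
    then have "(3 * real (card {zs \<in> samples ?A (q + q). P zs})) * (c * t)\<^sup>2 \<le>
        real n ^ (q + q) * (c * t)\<^sup>2"
      using ch by (simp only: mult_ac)
    then show ?thesis using ct by (simp only: mult_le_cancel_right_pos zero_less_power)
  qed
  show ?thesis
  proof (rule is_tester_detI[OF n], unfold pair_sum_labelled c_def[symmetric] H0_def[symmetric])
    fix f assume f: "has_runs n k f"
    have "H f \<le> real (alternations n f) * (real w ^ 3 / 6)"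
      unfolding H_def by (rule sum_disagreement_upper)
    also have "\<dots> \<le> real k * (real w ^ 3 / 6)"
      using f by (intro mult_right_mono) (auto simp: has_runs_def)
    finally have HH: "H f \<le> H0" by (simp add: H0_def)
    show "3 * real (card {zs \<in> samples {1..n} (q + q).
        \<not> pair_sum (disagreement w f) q zs \<le> c * ((1 + \<epsilon> / 16) * H0)}) \<le> real n ^ (q + q)"
    proof (rule count[of H0 f "\<epsilon> / 16 * H0"])
      fix zs assume "\<not> pair_sum (disagreement w f) q zs \<le> c * ((1 + \<epsilon> / 16) * H0)"
      moreover have "c * H f \<le> c * H0" using HH c_pos by simp
      moreover have "c * ((1 + \<epsilon> / 16) * H0) = c * H0 + c * (\<epsilon> / 16 * H0)"
        by (simp add: algebra_simps)
      ultimately show "c * (\<epsilon> / 16 * H0) \<le> \<bar>pair_sum (disagreement w f) q zs - c * H f\<bar>"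
        by linarith
    qed (use HH H0_pos \<epsilon> in auto)
  next
    fix f assume far: "far_from n (has_runs n k) \<epsilon> f"
    have HH: "(1 + \<epsilon> / 8) * H0 \<le> H f"
      unfolding H0_def H_def
      by (rule order_trans[OF gap[OF far] sum_disagreement_lower[OF w(2)]])
    have "1 * H0 \<le> (1 + \<epsilon> / 8) * H0" using \<epsilon> H0_pos by (intro mult_right_mono) auto
    then have H0H: "H0 \<le> H f" using HH by simp
    \<comment> \<open>A far function may have \<open>H f\<close> much larger than \<open>H0\<close>,
      so its deviation is measured relative to \<open>H f\<close>. The threshold stays below
      \<open>(1 - \<epsilon> / 18) * H f\<close> because \<open>(1 - \<epsilon> / 18) * (1 +
      \<epsilon> / 8) \<ge> 1 + \<epsilon> / 16\<close>.\<close>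
    have key: "(1 + \<epsilon> / 16) * H0 \<le> (1 - \<epsilon> / 18) * H f"
    proof -
      have "\<epsilon> * \<epsilon> \<le> \<epsilon>" using \<epsilon> by (simp add: mult_left_le)
      moreover have "(1 - \<epsilon> / 18) * (1 + \<epsilon> / 8) = 1 + 5 * \<epsilon> / 72 - \<epsilon> * \<epsilon> / 144"
        by (simp add: field_simps)
      ultimately have "1 + \<epsilon> / 16 \<le> (1 - \<epsilon> / 18) * (1 + \<epsilon> / 8)" using \<epsilon> by linarith
      then have "(1 + \<epsilon> / 16) * H0 \<le> ((1 - \<epsilon> / 18) * (1 + \<epsilon> / 8)) * H0"
        using H0_pos by (intro mult_right_mono) auto
      also have "\<dots> = (1 - \<epsilon> / 18) * ((1 + \<epsilon> / 8) * H0)" by simp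
      also have "\<dots> \<le> (1 - \<epsilon> / 18) * H f" using HH \<epsilon> by (intro mult_left_mono) auto
      finally show ?thesis .
    qed
    show "3 * real (card {zs \<in> samples {1..n} (q + q).
        pair_sum (disagreement w f) q zs \<le> c * ((1 + \<epsilon> / 16) * H0)}) \<le> real n ^ (q + q)"
    proof (rule count[of "H f" f "\<epsilon> / 18 * H f"])
      fix zs assume "pair_sum (disagreement w f) q zs \<le> c * ((1 + \<epsilon> / 16) * H0)"
      also have "\<dots> \<le> c * ((1 - \<epsilon> / 18) * H f)" using key c_pos by simp
      also have "\<dots> = c * H f - c * (\<epsilon> / 18 * H f)" by (simp add: algebra_simps)
      finally show "c * (\<epsilon> / 18 * H f) \<le> \<bar>pair_sum (disagreement w f) q zs - c * H f\<bar>"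
        by linarith
    qed (use H0H H0_pos in auto)
  qed
qed

section \<open>The consistency tester\<close>

text \<open>Each block is cut at the first point where both values have occurred \<open>t\<close>
  times. By minimality one value occurs at most \<open>t\<close> times in it, so a constant is a
  cheap approximation there. If the process stops before \<open>j\<close> blocks are complete, these
  constants form \<open>g\<close>, with alternations only at cut points.\<close>

lemma greedy_partition:
  fixes f :: "nat \<Rightarrow> bool"
  assumes t: "t \<ge> 1" and "a \<le> n"
  shows "(\<exists>c. mono c \<and> c 0 = a \<and> c j \<le> n \<and>
        (\<forall>i<j. \<forall>b. card {x \<in> {c i<..c (Suc i)}. f x = b} \<ge> t)) \<or>
      (\<exists>g. card {x \<in> {a<..n}. f x \<noteq> g x} < j * t \<and>
        card {i \<in> {a<..<n}. g i \<noteq> g (i + 1)} < j)"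
  using \<open>a \<le> n\<close>
proof (induction j arbitrary: a)
  case 0
  then show ?case by (intro disjI1 exI[of _ "\<lambda>_. a"]) (auto simp: mono_def)
next
  case (Suc j)
  define Q where "Q c \<longleftrightarrow> (\<forall>b. card {x \<in> {a<..c}. f x = b} \<ge> t)" for c
  show ?case
  proof (cases "Q n")
    case False
    then obtain b where b: "card {x \<in> {a<..n}. f x = b} < t"
      by (auto simp: Q_def not_le)
    then have "card {x \<in> {a<..n}. f x \<noteq> (\<not> b)} < Suc j * t" by simp
    then show ?thesis by (intro disjI2 exI[of _ "\<lambda>_. \<not> b"]) auto
  next
    case True
    define c where "c = (LEAST c. Q c)"
    have Qc: "Q c" unfolding c_def by (rule LeastI[of Q, OF True])
    have cn: "c \<le> n" unfolding c_def by (rule Least_le[of Q, OF True])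
    have ac: "a < c"
    proof (rule ccontr)
      assume "\<not> a < c"
      then have "{a<..c} = {}" by simp
      then have "card {x \<in> {a<..c}. f x = True} = 0" by simp
      moreover have "t \<le> card {x \<in> {a<..c}. f x = True}" using Qc unfolding Q_def by blast
      ultimately show False using t by linarith
    qed
    have "\<not> Q (c - 1)"
      using not_less_Least[of "c - 1" Q] ac unfolding c_def by simp
    then obtain b where b: "card {x \<in> {a<..c - 1}. f x = b} < t"
      by (auto simp: Q_def not_le)
    have "card {x \<in> {a<..c}. f x = b} \<le> card (insert c {x \<in> {a<..c - 1}. f x = b})"
      by (intro card_mono) auto
    also have "\<dots> \<le> t" using b by (simp add: card_insert_if)
    finally have bt: "card {x \<in> {a<..c}. f x = b} \<le> t" .
    from Suc.IH[OF cn] show ?thesis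
    proof (elim disjE exE conjE)
      fix d :: "nat \<Rightarrow> nat"
      assume d: "mono d" "d 0 = c" "d j \<le> n"
        "\<forall>i<j. \<forall>b. t \<le> card {x \<in> {d i<..d (Suc i)}. f x = b}"
      let ?d = "\<lambda>i. case i of 0 \<Rightarrow> a | Suc i \<Rightarrow> d i"
      have "mono ?d"
      proof (rule mono_iff_le_Suc[THEN iffD2], rule allI)
        fix i show "?d i \<le> ?d (Suc i)"
          using d ac monoD[OF d(1)] by (cases i) auto
      qed
      moreover have "\<forall>i<Suc j. \<forall>b. t \<le> card {x \<in> {?d i<..?d (Suc i)}. f x = b}"
        using d Qc by (auto simp: Q_def less_Suc_eq_0_disj)
      ultimately show ?thesis using d by (intro disjI1 exI[of _ ?d]) auto
    next
      fix g
      assume g: "card {x \<in> {c<..n}. f x \<noteq> g x} < j * t"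
        "card {i \<in> {c<..<n}. g i \<noteq> g (i + 1)} < j"
      let ?g = "\<lambda>x. if x \<le> c then \<not> b else g x"
      have "{x \<in> {a<..n}. f x \<noteq> ?g x} \<subseteq> {x \<in> {a<..c}. f x = b} \<union> {x \<in> {c<..n}. f x \<noteq> g x}"
        by auto
      then have "card {x \<in> {a<..n}. f x \<noteq> ?g x} \<le>
          card {x \<in> {a<..c}. f x = b} + card {x \<in> {c<..n}. f x \<noteq> g x}"
        by (intro order_trans[OF card_mono card_Un_le]) auto
      also have "\<dots> < Suc j * t" using g bt by simp
      finally have 1: "card {x \<in> {a<..n}. f x \<noteq> ?g x} < Suc j * t" .
      have "{i \<in> {a<..<n}. ?g i \<noteq> ?g (i + 1)} \<subseteq> insert c {i \<in> {c<..<n}. g i \<noteq> g (i + 1)}"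
        by (auto split: if_splits)
      then have "card {i \<in> {a<..<n}. ?g i \<noteq> ?g (i + 1)} \<le>
          card (insert c {i \<in> {c<..<n}. g i \<noteq> g (i + 1)})"
        by (intro card_mono) auto
      also have "\<dots> < Suc j" using g by (simp add: card_insert_if)
      finally show ?thesis using 1 by (intro disjI2 exI[of _ ?g]) simp
    qed
  qed
qed

text \<open>Each block contains an alternation strictly between its end points, and these are
  distinct for different blocks.\<close>

lemma alternations_ge_blocks:
  assumes c: "mono c" "c k \<le> n"
    and hit: "\<And>i b. i < k \<Longrightarrow> \<exists>x\<in>{c i<..c (Suc i)}. g x = b"
  shows "k \<le> alternations n g"
proof -
  have "\<exists>p. c i < p \<and> p < c (Suc i) \<and> g p \<noteq> g (p + 1)" if i: "i < k" for i
  proof -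
    obtain x y where x: "x \<in> {c i<..c (Suc i)}" "g x = True"
      and y: "y \<in> {c i<..c (Suc i)}" "g y = False"
      using hit[OF i, of True] hit[OF i, of False] by blast
    have "\<exists>p\<in>{min x y..<max x y}. g p \<noteq> g (p + 1)"
      using x y by (intro alternation_between) (auto simp: min_def max_def not_le le_less)
    then show ?thesis using x y by fastforce
  qed
  then obtain p where p: "\<And>i. i < k \<Longrightarrow> c i < p i \<and> p i < c (Suc i) \<and> g (p i) \<noteq> g (p i + 1)"
    by metis
  have "inj_on p {..<k}"
  proof (rule linorder_inj_onI)
    fix i j assume ij: "i < j" "i \<in> {..<k}" "j \<in> {..<k}"
    then have "c (Suc i) \<le> c j" using c(1) by (simp add: monoD)
    then show "p i \<noteq> p j" using p[of i] p[of j] ij by auto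
  qed auto
  moreover have "p ` {..<k} \<subseteq> {i \<in> {1..<n}. g i \<noteq> g (i + 1)}"
  proof safe
    fix i assume "i < k"
    then have "c (Suc i) \<le> c k" using c(1) by (simp add: monoD)
    then show "p i \<in> {1..<n}" using p[OF \<open>i < k\<close>] c(2) by auto
  qed (use p in auto)
  ultimately have "card {..<k} \<le> card {i \<in> {1..<n}. g i \<noteq> g (i + 1)}"
    by (rule card_inj_on_le) simp
  then show ?thesis by (simp add: alternations_def)
qed

lemma card_samples_avoiding:
  assumes "finite A" "B \<subseteq> A"
  shows "card {xs \<in> samples A q. set xs \<inter> B = {}} = (card A - card B) ^ q"
proof -
  have "{xs \<in> samples A q. set xs \<inter> B = {}} = samples (A - B) q" by auto
  then show ?thesis using assms
    by (simp add: card_lists_length_eq card_Diff_subset finite_subset)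
qed

text \<open>Functions with \<open>k\<close> runs are always accepted. For a far function,
  \<open>greedy_partition\<close> gives \<open>k\<close> blocks in which both values are frequent; a
  sample meeting all \<open>2 * k\<close> value classes forces \<open>k\<close> alternations on
  every consistent function.\<close>

lemma consistency_tester:
  assumes n: "n \<ge> 1" and k: "k \<ge> 1" and \<epsilon>: "\<epsilon> > real k ^ 2 / real n" "\<epsilon> \<le> 1"
    and q: "real q \<ge> 2 * real k / \<epsilon> * ln (6 * real k)"
  shows "is_tester n (has_runs n k) \<epsilon> q
    (\<lambda>s. return_pmf (\<exists>g. has_runs n k g \<and> (\<forall>(x, b)\<in>set s. g x = b)))"
proof (rule is_tester_detI[OF n])
  fix f assume f: "has_runs n k f"
  then have "(\<exists>g. has_runs n k g \<and> (\<forall>(x, b)\<in>set (map (\<lambda>x. (x, f x)) xs). g x = b))" for xs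
    by (intro exI[of _ f]) auto
  then show "3 * real (card {xs \<in> samples {1..n} q.
      \<not> (\<exists>g. has_runs n k g \<and> (\<forall>(x, b)\<in>set (map (\<lambda>x. (x, f x)) xs). g x = b))}) \<le> real n ^ q"
    by simp
next
  fix f assume far: "far_from n (has_runs n k) \<epsilon> f"
  have npos: "real n > 0" and kpos: "real k > 0" using n k by auto
  have kn: "real k ^ 2 < \<epsilon> * real n" using \<epsilon>(1) npos by (simp add: pos_divide_less_eq)
  \<comment> \<open>The largest \<open>t\<close> with \<open>k * t \<le> \<epsilon> * n\<close>.
    Since \<open>\<epsilon> * n > k^2\<close>, the quotient exceeds 1, so rounding down loses at
    most a factor 2.\<close>
  define t where "t = nat \<lfloor>\<epsilon> * real n / real k\<rfloor>"
  have epos: "\<epsilon> > 0" using \<epsilon>(1) by (smt (verit) divide_nonneg_nonneg of_nat_0_le_iff zero_le_power)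
  have "1 \<le> real k" using k by simp
  moreover have "real k < \<epsilon> * real n / real k"
    using kn kpos by (simp add: pos_less_divide_eq power2_eq_square)
  ultimately have gt1: "1 < \<epsilon> * real n / real k" by linarith
  have t1: "t \<ge> 1" unfolding t_def using gt1 by linarith
  have t_le: "real t \<le> \<epsilon> * real n / real k" unfolding t_def using gt1 by linarith
  have t_ge: "real t \<ge> \<epsilon> * real n / (2 * real k)"
  proof -
    have "real t > \<epsilon> * real n / real k - 1" unfolding t_def using gt1 by linarith
    then show ?thesis using t1 by (simp add: field_simps)
  qed
  have "\<not> (\<exists>g. card {x \<in> {0<..n}. f x \<noteq> g x} < k * t \<and>
        card {i \<in> {0<..<n}. g i \<noteq> g (i + 1)} < k)"
  proof
    assume "\<exists>g. card {x \<in> {0<..n}. f x \<noteq> g x} < k * t \<and>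
        card {i \<in> {0<..<n}. g i \<noteq> g (i + 1)} < k"
    then obtain g where g: "card {x \<in> {0<..n}. f x \<noteq> g x} < k * t"
        "card {i \<in> {0<..<n}. g i \<noteq> g (i + 1)} < k" by auto
    have s: "{0<..n} = {1..n}" "{0<..<n} = {1..<n}" by auto
    have "\<epsilon> * real n \<le> real (card {x \<in> {1..n}. f x \<noteq> g x})"
      using g s by (intro far_from_has_runsD[OF far _ n]) (simp add: alternations_def)
    also have "\<dots> < real (k * t)" using g(1) s(1) by (simp only: of_nat_less_iff)
    also have "\<dots> \<le> \<epsilon> * real n" using t_le kpos by (simp add: pos_le_divide_eq mult.commute)
    finally show False by simp
  qed
  then obtain c where c: "mono c" "c k \<le> n"
      "\<And>i b. i < k \<Longrightarrow> t \<le> card {x \<in> {c i<..c (Suc i)}. f x = b}"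
    using greedy_partition[OF t1, of 0 n k f] by auto
  define B where "B i b = {x \<in> {c i<..c (Suc i)}. f x = b}" for i b
  have Bsub: "B i b \<subseteq> {1..n}" if "i < k" for i b
  proof -
    have "c (Suc i) \<le> c k" using c(1) that by (simp add: monoD)
    then show ?thesis using c(2) by (auto simp: B_def)
  qed
  have "{xs \<in> samples {1..n} q. \<exists>g. has_runs n k g \<and> (\<forall>(x, b)\<in>set (map (\<lambda>x. (x, f x)) xs). g x = b)}
      \<subseteq> (\<Union>(i, b)\<in>{..<k} \<times> UNIV. {xs \<in> samples {1..n} q. set xs \<inter> B i b = {}})" (is "?L \<subseteq> ?R")
  proof (intro subsetI, rule ccontr)
    fix xs assume xs: "xs \<in> ?L" "xs \<notin> ?R"
    then obtain g where g: "has_runs n k g" "\<And>x. x \<in> set xs \<Longrightarrow> g x = f x" by auto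
    have "\<exists>x\<in>{c i<..c (Suc i)}. g x = b" if "i < k" for i b
    proof -
      have "set xs \<inter> B i b \<noteq> {}" using xs that by blast
      then show ?thesis using g by (fastforce simp: B_def)
    qed
    then have "k \<le> alternations n g" by (intro alternations_ge_blocks[OF c(1,2)]) auto
    then show False using g(1) by (simp add: has_runs_def)
  qed
  moreover have "finite ?R"
    by (rule finite_subset[OF _ finite_lists_length_eq[of "{1..n}" q]]) auto
  ultimately have "real (card ?L) \<le> real (card ?R)"
    by (intro of_nat_mono card_mono)
  also have "\<dots> \<le> (\<Sum>(i, b)\<in>{..<k} \<times> UNIV. real (card {xs \<in> samples {1..n} q. set xs \<inter> B i b = {}}))"
    using card_UN_le[of "{..<k} \<times> UNIV" "\<lambda>(i, b). {xs \<in> samples {1..n} q. set xs \<inter> B i b = {}}"]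
    by (simp add: case_prod_unfold flip: of_nat_sum)
  \<comment> \<open>Each class has density at least \<open>\<epsilon> / (2 * k)\<close>, so it is
    missed with probability at most
    \<open>exp (- q * \<epsilon> / (2 * k)) \<le> 1 / (6 * k)\<close>; the \<open>2 * k\<close>
    classes together contribute 1/3.\<close>
  also have "\<dots> \<le> (\<Sum>(i, b)\<in>{..<k} \<times> (UNIV :: bool set). real n ^ q / (6 * real k))"
  proof (rule sum_mono, clarsimp)
    fix i b assume i: "i < k"
    have ct: "t \<le> card (B i b)" using c(3)[OF i] by (simp add: B_def)
    have cn: "card (B i b) \<le> n" using card_mono[OF _ Bsub[OF i], of b] by simp
    have "real (card {xs \<in> samples {1..n} q. set xs \<inter> B i b = {}}) = (real n - real (card (B i b))) ^ q"
      using card_samples_avoiding[OF _ Bsub[OF i], of q b] cn by (simp add: of_nat_diff)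
    also have "\<dots> \<le> (real n * exp (- \<epsilon> / (2 * real k))) ^ q"
    proof (rule power_mono)
      have "real n - real (card (B i b)) \<le> real n * (1 + (- \<epsilon> / (2 * real k)))"
        using t_ge ct by (simp add: field_simps)
      also have "\<dots> \<le> real n * exp (- \<epsilon> / (2 * real k))"
        by (intro mult_left_mono exp_ge_add_one_self) simp
      finally show "real n - real (card (B i b)) \<le> real n * exp (- \<epsilon> / (2 * real k))" .
    qed (use cn in simp)
    also have "\<dots> = real n ^ q * exp (- (real q * \<epsilon> / (2 * real k)))"
      by (simp add: power_mult_distrib flip: exp_of_nat_mult)
    also have "\<dots> \<le> real n ^ q * exp (- ln (6 * real k))"
    proof -
      have "ln (6 * real k) \<le> real q * \<epsilon> / (2 * real k)"
        using q epos kpos by (simp add: field_simps)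
      then show ?thesis by (intro mult_left_mono) auto
    qed
    also have "\<dots> = real n ^ q / (6 * real k)"
      using kpos by (simp add: exp_minus field_simps)
    finally show "real (card {xs. set xs \<subseteq> {Suc 0..n} \<and> length xs = q \<and> set xs \<inter> B i b = {}})
        \<le> real n ^ q / (6 * real k)" by (simp add: conj_assoc)
  qed
  also have "\<dots> = real n ^ q / 3" using kpos by (simp add: card_cartesian_product)
  finally show "3 * real (card ?L) \<le> real n ^ q" by simp
qed

section \<open>Query complexity\<close>

text \<open>From \<open>ln 6 \<le> 5\<close> and \<open>ln k \<le> L\<close> follows
  \<open>ln (6 * k) \<le> 6 * L\<close>; the constant 13 is \<open>2 * 6\<close> plus one for
  rounding up.\<close>

lemma consistency_sample_size:
  fixes k :: nat and \<epsilon> :: real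
  assumes k: "k \<ge> 1" and \<epsilon>: "0 < \<epsilon>" "\<epsilon> \<le> 1"
  shows "\<exists>q::nat. 2 * real k / \<epsilon> * ln (6 * real k) \<le> real q \<and>
    real q \<le> 13 * (real k * max 1 (log 2 (real k)) / \<epsilon>)"
proof -
  define L where "L = max 1 (log 2 (real k))"
  have k1: "1 \<le> real k" using k by simp
  have "ln (real k) \<le> L"
  proof -
    have "ln (real k) = log 2 (real k) * ln 2" by (simp add: log_def)
    also have "\<dots> \<le> log 2 (real k) * 1"
      using k1 ln_2_less_1 by (intro mult_left_mono) auto
    finally show ?thesis by (simp add: L_def)
  qed
  moreover have "ln 6 \<le> (5::real)" using ln_le_minus_one[of "6::real"] by simp
  moreover have "1 \<le> L" by (simp add: L_def)
  ultimately have ln_le: "ln (6 * real k) \<le> 6 * L" using k1 by (simp add: ln_mult)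
  have kL: "1 \<le> real k * L / \<epsilon>"
  proof -
    have "1 * 1 \<le> real k * L" using k1 \<open>1 \<le> L\<close> by (intro mult_mono) auto
    then show ?thesis using \<epsilon> by (simp add: pos_le_divide_eq)
  qed
  let ?x = "2 * real k / \<epsilon> * ln (6 * real k)"
  have "?x \<le> 2 * real k / \<epsilon> * (6 * L)"
    using ln_le \<epsilon> by (intro mult_left_mono) auto
  then have x: "?x \<le> 12 * (real k * L / \<epsilon>)" by simp
  have "0 \<le> ?x" using \<epsilon> k1 by simp
  then have "real (nat \<lceil>?x\<rceil>) \<le> ?x + 1" by linarith
  then have "real (nat \<lceil>?x\<rceil>) \<le> 13 * (real k * L / \<epsilon>)" using x kL by linarith
  then show ?thesis unfolding L_def by (intro exI[of _ "nat \<lceil>?x\<rceil>"]) linarith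
qed

text \<open>Serves to compare the two query bounds when \<open>k * \<epsilon>^5\<close> is bounded;
  it follows from \<open>ln s \<le> s - 1\<close> at \<open>s = sqrt k\<close>.\<close>

lemma max_log_le_sqrt:
  fixes k :: nat
  assumes "k \<ge> 1"
  shows "max 1 (log 2 (real k)) \<le> 4 * sqrt (real k)"
proof -
  have k1: "1 \<le> real k" using assms by simp
  then have s1: "1 \<le> sqrt (real k)" by simp
  have "ln (real k) = 2 * ln (sqrt (real k))" using k1 by (simp add: ln_sqrt)
  also have "\<dots> \<le> 2 * sqrt (real k)" using ln_le_minus_one[of "sqrt (real k)"] s1 by simp
  finally have "ln (real k) \<le> 2 * sqrt (real k)" .
  moreover have "1 / 2 \<le> ln (2::real)" using ln2_ge_two_thirds by simp
  ultimately have "ln (real k) / ln 2 \<le> 2 * sqrt (real k) / (1 / 2)"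
    using s1 k1 by (intro frac_le) auto
  then have "log 2 (real k) \<le> 4 * sqrt (real k)" by (simp add: log_def)
  then show ?thesis using s1 by linarith
qed

lemma collision_sample_size:
  fixes n k :: nat and \<epsilon> :: real
  assumes n: "n \<ge> 1" and k: "k \<ge> 1" and \<epsilon>: "real k ^ 2 / real n < \<epsilon>" "\<epsilon> \<le> 1"
    and large: "32768 \<le> real k * \<epsilon> ^ 5"
  shows "\<exists>q T. real q \<le> 33554432 * (sqrt (real k) / \<epsilon> ^ 6) \<and> is_tester n (has_runs n k) \<epsilon> q T"
proof -
  define N K where "N = real n" and "K = real k"
  have N1: "1 \<le> N" and K1: "1 \<le> K" using n k by (auto simp: N_def K_def)
  have "0 < real k ^ 2 / real n" using n k by simp
  then have e0: "0 < \<epsilon>" using \<epsilon>(1) by linarith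
  have kn: "K\<^sup>2 < \<epsilon> * N" using \<epsilon>(1) N1 by (simp add: N_def K_def pos_divide_less_eq)
  have K_pow: "32768 \<le> K * \<epsilon> ^ m" if "m \<le> 5" for m
  proof -
    have "K * \<epsilon> ^ 5 \<le> K * \<epsilon> ^ m" using that e0 \<epsilon>(2) K1 by (intro mult_left_mono power_decreasing) auto
    then show ?thesis using large by (simp add: K_def)
  qed
  \<comment> \<open>The largest window length allowed by \<open>w_le\<close> in
    \<open>far_from_window_gap\<close>. The assumption \<open>k^2 < \<epsilon> * n\<close> gives
    \<open>X \<ge> \<epsilon> * k / 64\<close>; with the factor 2 lost in rounding,
    \<open>w_ge\<close> amounts to
    \<open>k * \<epsilon>^3 \<ge> 2 * 64 * 256 = 32768\<close>.\<close>
  define X where "X = \<epsilon>\<^sup>2 * N / (64 * K)"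
  have X_ge: "\<epsilon> * K / 64 \<le> X"
  proof -
    have "\<epsilon> * K\<^sup>2 \<le> \<epsilon> * (\<epsilon> * N)" using kn e0 by (intro mult_left_mono) auto
    then show ?thesis using K1 by (simp add: X_def field_simps power2_eq_square)
  qed
  have "32768 \<le> K * \<epsilon> ^ 1" by (rule K_pow) simp
  then have X2: "2 \<le> X" using X_ge by (simp add: mult.commute)
  define w where "w = nat \<lfloor>X\<rfloor>"
  define W where "W = real w"
  have W_le: "W \<le> X" and W_gt: "X - 1 < W" unfolding W_def w_def using X2 by linarith+
  have W_ge: "X / 2 \<le> W" using W_gt X2 by linarith
  have W1: "1 \<le> W" using W_ge X2 by linarith
  have KW: "64 * K * W \<le> \<epsilon>\<^sup>2 * N"
  proof -
    have "64 * K * W \<le> 64 * K * X" using W_le K1 by (intro mult_left_mono) auto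
    also have "\<dots> = \<epsilon>\<^sup>2 * N" using K1 by (simp add: X_def)
    finally show ?thesis .
  qed
  have W256: "256 \<le> W * \<epsilon>\<^sup>2"
  proof -
    have "32768 \<le> K * \<epsilon> ^ 3" by (rule K_pow) simp
    then have "256 \<le> (\<epsilon> * K / 64) / 2 * \<epsilon>\<^sup>2" by (simp add: power2_eq_square power3_eq_cube mult_ac)
    also have "\<dots> \<le> W * \<epsilon>\<^sup>2" using X_ge W_ge by (intro mult_right_mono) auto
    finally show ?thesis .
  qed
  have wn: "w \<le> n"
  proof -
    have "1 * W \<le> 64 * K * W" using K1 W1 by (intro mult_right_mono) auto
    moreover have "\<epsilon>\<^sup>2 * N \<le> 1 * N" using e0 \<epsilon>(2) N1 by (intro mult_right_mono) (auto simp: power_le_one)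
    ultimately have "W \<le> N" using KW by linarith
    then show ?thesis by (simp add: W_def N_def)
  qed
  have N_le: "N \<le> 128 * K * W / \<epsilon>\<^sup>2"
    using W_ge K1 e0 by (simp add: X_def field_simps)
  define Y where "Y = 8388608 * (sqrt K / \<epsilon> ^ 6)"
  have "1 \<le> sqrt K / \<epsilon> ^ 6"
  proof -
    have "\<epsilon> ^ 6 \<le> 1" using e0 \<epsilon>(2) by (intro power_le_one) auto
    also have "1 \<le> sqrt K" using K1 by simp
    finally show ?thesis using e0 by (simp add: pos_le_divide_eq)
  qed
  then have Y1: "8388608 \<le> Y" by (simp add: Y_def)
  define q where "q = nat \<lceil>Y\<rceil>"
  define Q where "Q = real q"
  have QY: "Y \<le> Q" and Q_le: "Q \<le> 2 * Y" unfolding Q_def q_def using Y1 by linarith+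
  \<comment> \<open>The two summands of the sample-size condition each get half of the right-hand
    side: \<open>QK\<close> serves \<open>N^2\<close> and \<open>Q4\<close> the cross term.
    Substituting \<open>N_le\<close> produces the factors \<open>16384 = 128^2\<close> and
    \<open>512 = 4 * 128\<close>.\<close>
  have QK: "2 * 5832 * 16384 * K / \<epsilon> ^ 6 \<le> Q\<^sup>2"
  proof -
    have "2 * 5832 * 16384 * K / \<epsilon> ^ 6 \<le> 8388608\<^sup>2 * K / \<epsilon> ^ 12"
    proof (rule frac_le)
      show "\<epsilon> ^ 12 \<le> \<epsilon> ^ 6" using e0 \<epsilon>(2) by (intro power_decreasing) auto
    qed (use K1 e0 in auto)
    also have "\<dots> = Y\<^sup>2" using K1 by (simp add: Y_def power_mult_distrib power_divide flip: power_mult)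
    also have "\<dots> \<le> Q\<^sup>2" using QY Y1 by (intro power_mono) auto
    finally show ?thesis .
  qed
  have Q4: "2 * 5832 * 512 / \<epsilon> ^ 4 \<le> Q"
  proof -
    have "2 * 5832 * 512 / \<epsilon> ^ 4 \<le> 8388608 * sqrt K / \<epsilon> ^ 6"
    proof (rule frac_le)
      show "\<epsilon> ^ 6 \<le> \<epsilon> ^ 4" using e0 \<epsilon>(2) by (intro power_decreasing) auto
      have "1 \<le> sqrt K" using K1 by simp
      then show "2 * 5832 * 512 \<le> 8388608 * sqrt K" by linarith
    qed (use e0 K1 in auto)
    then show ?thesis using QY by (simp add: Y_def)
  qed
  have "5832 * (N\<^sup>2 + 4 * Q * W * N) \<le> Q\<^sup>2 * \<epsilon>\<^sup>2 * K * W\<^sup>2"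
  proof -
    have "5832 * N\<^sup>2 \<le> 5832 * (128 * K * W / \<epsilon>\<^sup>2)\<^sup>2"
      using N_le N1 by (intro mult_left_mono power_mono) auto
    also have "\<dots> = (2 * 5832 * 16384 * K / \<epsilon> ^ 6) * (\<epsilon>\<^sup>2 * K * W\<^sup>2 / 2)"
      using e0 by (simp add: field_simps power_numeral_reduce)
    also have "\<dots> \<le> Q\<^sup>2 * (\<epsilon>\<^sup>2 * K * W\<^sup>2 / 2)"
      using QK K1 by (intro mult_right_mono) auto
    finally have 1: "5832 * N\<^sup>2 \<le> Q\<^sup>2 * \<epsilon>\<^sup>2 * K * W\<^sup>2 / 2" by simp
    have "5832 * (4 * Q * W * N) \<le> 5832 * (4 * Q * W * (128 * K * W / \<epsilon>\<^sup>2))"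
      using N_le W1 by (intro mult_left_mono) (auto simp: Q_def)
    also have "\<dots> = (2 * 5832 * 512 / \<epsilon> ^ 4) * (Q * \<epsilon>\<^sup>2 * K * W\<^sup>2 / 2)"
      using e0 by (simp add: field_simps power_numeral_reduce)
    also have "\<dots> \<le> Q * (Q * \<epsilon>\<^sup>2 * K * W\<^sup>2 / 2)"
      using Q4 K1 by (intro mult_right_mono) (auto simp: Q_def)
    finally have 2: "5832 * (4 * Q * W * N) \<le> Q\<^sup>2 * \<epsilon>\<^sup>2 * K * W\<^sup>2 / 2"
      by (simp add: power2_eq_square mult_ac)
    from 1 2 show ?thesis by (simp add: distrib_left)
  qed
  moreover have "8 \<le> K * \<epsilon>" using \<open>32768 \<le> K * \<epsilon> ^ 1\<close> by simp
  moreover have "1 \<le> w" "1 \<le> q" using W1 QY Y1 by (auto simp: W_def Q_def)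
  ultimately have "is_tester n (has_runs n k) \<epsilon> (q + q) (\<lambda>s. return_pmf
    (pair_sum (labelled_disagreement w) q s \<le>
      (real q)\<^sup>2 / (real n)\<^sup>2 * ((1 + \<epsilon> / 16) * (real k * real w ^ 3 / 6))))"
    using KW W256 e0 \<epsilon>(2) n k wn unfolding N_def K_def W_def Q_def
    by (intro collision_tester far_from_window_gap) auto
  moreover have "real (q + q) \<le> 33554432 * (sqrt (real k) / \<epsilon> ^ 6)"
    using Q_le by (simp add: Q_def Y_def K_def)
  ultimately show ?thesis by blast
qed

theorem theorem2p9:
  "\<exists>C::real. C > 0 \<and>
    (\<forall>(n::nat) (k::nat) (\<epsilon>::real).
      n \<ge> 1 \<longrightarrow> k \<ge> 1 \<longrightarrow> \<epsilon> > real k ^ 2 / real n \<longrightarrow>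
      (\<exists>(q::nat) (T::sample_tester).
        real q \<le> C * query_bound k \<epsilon> \<and> is_tester n (has_runs n k) \<epsilon> q T))"
proof -
  have main: "\<exists>(q::nat) (T::sample_tester).
      real q \<le> 33554432 * query_bound k \<epsilon> \<and> is_tester n (has_runs n k) \<epsilon> q T"
    if n: "n \<ge> 1" and k: "k \<ge> 1" and \<epsilon>: "\<epsilon> > real k ^ 2 / real n"
    for n k :: nat and \<epsilon> :: real
  proof -
    have "0 < real k ^ 2 / real n" using n k by simp
    then have e0: "0 < \<epsilon>" using \<epsilon> by linarith
    define a where "a = real k * max 1 (log 2 (real k)) / \<epsilon>"
    define b where "b = sqrt (real k) / \<epsilon> ^ 6"
    have ab: "0 \<le> a" "0 \<le> b" using e0 by (auto simp: a_def b_def)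
    have qb: "query_bound k \<epsilon> = min a b" by (simp add: query_bound_def a_def b_def)
    show ?thesis
    proof (cases "\<epsilon> \<le> 1")
      case False
      \<comment> \<open>The constant function \<open>True\<close> has one run and is within relative
        distance 1 of every \<open>f\<close>, so for \<open>\<epsilon> > 1\<close> nothing is far
        and no query is made.\<close>
      have "\<not> far_from n (has_runs n k) \<epsilon> f" for f
      proof
        assume far: "far_from n (has_runs n k) \<epsilon> f"
        have "\<epsilon> * real n \<le> real (card {x \<in> {1..n}. f x \<noteq> True})"
          using n k by (intro far_from_has_runsD[OF far]) (auto simp: alternations_def)
        also have "\<dots> \<le> real (card {1..n})" by (intro of_nat_mono card_mono) auto
        finally show False using False n by simp
      qed
      then have "is_tester n (has_runs n k) \<epsilon> 0 (\<lambda>s. return_pmf True)"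
        by (intro is_tester_detI[OF n]) auto
      then show ?thesis using ab qb by (intro exI[of _ 0]) auto
    next
      case True
      have A: "\<exists>(q::nat) (T::sample_tester). real q \<le> 33554432 * query_bound k \<epsilon> \<and>
          is_tester n (has_runs n k) \<epsilon> q T" if "13 * a \<le> 33554432 * min a b"
      proof -
        obtain q :: nat where q: "2 * real k / \<epsilon> * ln (6 * real k) \<le> real q" "real q \<le> 13 * a"
          using consistency_sample_size[OF k e0 True] unfolding a_def by blast
        have "real q \<le> 33554432 * query_bound k \<epsilon>" using q(2) that qb by linarith
        then show ?thesis using consistency_tester[OF n k \<epsilon> True q(1)] by blast
      qed
      consider "a \<le> b" | "b < a" "real k * \<epsilon> ^ 5 \<le> 32768" | "b < a" "32768 \<le> real k * \<epsilon> ^ 5"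
        by linarith
      then show ?thesis
      proof cases
        case 1
        then show ?thesis using ab by (intro A) simp
      next
        case 2
        \<comment> \<open>For bounded \<open>k * \<epsilon>^5\<close> the consistency tester already
          has the right order: \<open>13 * 4 * 32768\<close> is below the final constant
          \<open>33554432 = 4 * 8388608\<close>, which accounts for the two halves of the collision
          sample and its rounding.\<close>
        have "a \<le> real k * (4 * sqrt (real k)) / \<epsilon>"
          unfolding a_def using max_log_le_sqrt[OF k] e0
          by (intro divide_right_mono mult_left_mono) auto
        also have "\<dots> = 4 * (real k * \<epsilon> ^ 5) * b"
          using e0 by (simp add: b_def field_simps power_numeral_reduce)
        also have "\<dots> \<le> 4 * 32768 * b" using 2 ab by (intro mult_right_mono) auto
        finally show ?thesis using ab 2 by (intro A) simp
      next
        case 3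
        then show ?thesis using collision_sample_size[OF n k \<epsilon> True] qb by (auto simp: b_def min_def)
      qed
    qed
  qed
  then show ?thesis by (intro exI[of _ 33554432]) simp
qed

end
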